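(* Let $k$ be any field. There exist two geometrically irreducible closed curves $C,D\subset\mathbb{A}^2$ which are not isomorphic, but whose complements $\mathbb{A}^2\setminus C$ and $\mathbb{A}^2\setminus D$ are isomorphic. Furthermore, $C$ and $D$ can be chosen of degree $7$ if $k$ has more than $2$ elements, and of degree $13$ if $k$ has $2$ elements.
   Context: All varieties and morphisms are over $k$. Geometrically irreducible means irreducible over an algebraic closure $\bar k$. *)

theory Defs
  imports "HOL-Algebra.Algebraic_Closure_Type"
          "HOL-Computational_Algebra.Polynomial_Factorial"
          "HOL-Computational_Algebra.Fraction_Field"
begin

text \<open>Bivariate polynomials k[x,y] are represented as (k[x])[y]:
  the outer variable is y, the coefficients are polynomials in x.\<close>
type_synonym 'a bipoly = "'a poly poly"

definition const2 :: "'a::zero \<Rightarrow> 'a bipoly" where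
  "const2 c = [:[:c:]:]"

definition X2 :: "'a::comm_semiring_1 bipoly" where
  "X2 = [:[:0, 1:]:]"

definition Y2 :: "'a::comm_semiring_1 bipoly" where
  "Y2 = [:0, 1:]"

definition eval2 :: "('a::zero \<Rightarrow> 'b::comm_semiring_1) \<Rightarrow> 'a bipoly \<Rightarrow> 'b \<Rightarrow> 'b \<Rightarrow> 'b" where
  "eval2 e p u v = poly (map_poly (\<lambda>c. poly (map_poly e c) u) p) v"

definition total_degree :: "'a::zero bipoly \<Rightarrow> nat" where
  "total_degree p = Max {i + j | i j. coeff (coeff p j) i \<noteq> 0}"

definition geom_irreducible :: "'a::field bipoly \<Rightarrow> bool" where
  "geom_irreducible f \<longleftrightarrow> irreducible (map_poly (map_poly to_ac) f)"

text \<open>k-algebra isomorphism of the coordinate rings k[x,y]/(g) and k[x,y]/(f) of the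
  closed curves V(g) and V(f), written out on representatives: phi is a map
  k[x,y] -> k[x,y] which is well defined modulo the ideals, a k-algebra homomorphism
  modulo (f), injective and surjective on the quotients.\<close>
definition curves_isomorphic :: "'a::field bipoly \<Rightarrow> 'a bipoly \<Rightarrow> bool" where
  "curves_isomorphic g f \<longleftrightarrow>
     (\<exists>\<phi> :: 'a bipoly \<Rightarrow> 'a bipoly.
        (\<forall>p q. g dvd p - q \<longrightarrow> f dvd \<phi> p - \<phi> q) \<and>
        (\<forall>p q. f dvd \<phi> (p + q) - (\<phi> p + \<phi> q)) \<and>
        (\<forall>p q. f dvd \<phi> (p * q) - \<phi> p * \<phi> q) \<and>
        (\<forall>c. f dvd \<phi> (const2 c) - const2 c) \<and>
        (\<forall>p q. f dvd \<phi> p - \<phi> q \<longrightarrow> g dvd p - q) \<and>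
        (\<forall>r. \<exists>p. f dvd \<phi> p - r))"

text \<open>The coordinate ring k[x,y][1/f] of the principal open set A^2 minus V(f),
  as a subring of the fraction field k(x,y).\<close>
definition loc_ring :: "'a::field bipoly \<Rightarrow> 'a bipoly fract set" where
  "loc_ring f = {to_fract P / to_fract f ^ n | P n. True}"

text \<open>k-algebra isomorphism of the coordinate rings of A^2 minus V(g) and A^2 minus V(f)
  (both affine varieties, being principal open subsets).\<close>
definition complements_isomorphic :: "'a::field bipoly \<Rightarrow> 'a bipoly \<Rightarrow> bool" where
  "complements_isomorphic g f \<longleftrightarrow>
     (\<exists>\<phi> :: 'a bipoly fract \<Rightarrow> 'a bipoly fract.
        bij_betw \<phi> (loc_ring g) (loc_ring f) \<and>
        (\<forall>u\<in>loc_ring g. \<forall>v\<in>loc_ring g. \<phi> (u + v) = \<phi> u + \<phi> v \<and> \<phi> (u * v) = \<phi> u * \<phi> v) \<and>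
        (\<forall>c. \<phi> (to_fract (const2 c)) = to_fract (const2 c)))"

end

theory Submission
  imports Defs
begin

text \<open>
  Fix \<open>n > 0\<close> and \<open>f = c0 + c1 t + e1 t^n + e0 t^(n+1)\<close> with \<open>c0\<close> and \<open>e0\<close> nonzero. Start from a
  Hirzebruch surface over the \<open>t\<close>-line with the two sections \<open>y = 0\<close> and \<open>y = f(t)\<close>, blow up the first
  over \<open>t = \<infinity>\<close> and the second over \<open>t = 0\<close>, and remove the boundary together with the first section:
  what remains is an affine plane, with coordinates \<open>X = t/y\<close> and \<open>W\<close>, where \<open>Z = 1/y\<close> satisfies
  \<open>c0 Z = 1 - c1 X + X^n W\<close>. In it the second section is the curve \<open>Z^n W + e1 Z + e0 X = 0\<close> of
  degree \<open>n^2 + n + 1\<close>, with coordinate ring \<open>k[t, 1/f]\<close>. Removing the second section instead of the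
  first gives, after \<open>t \<mapsto> 1/t\<close>, the same construction for the reversed polynomial
  \<open>f* = t^(n+1) f(1/t)\<close>. So the curves attached to \<open>f\<close> and \<open>f*\<close> have isomorphic complements.

  An isomorphism of the curves yields a Moebius transformation mapping \<open>\<infinity>\<close> and the roots of \<open>f*\<close> onto
  \<open>\<infinity>\<close> and the roots of \<open>f\<close>, so it remains to choose \<open>f\<close> such that there is none:
  \<open>t^3 + t^2 + b\<close> with \<open>b\<close>, \<open>27 b + 1\<close> and \<open>27 b + 4\<close> nonzero if the field has more than two elements
  (\<open>27 b + 4 = 0\<close> is a double root, \<open>27 b + 1 = 0\<close> an equality of \<open>j\<close>-invariants), and
  \<open>t^4 + t + 1\<close> over the field with two elements.
\<close>

section \<open>Unital ring homomorphisms and bivariate polynomials\<close>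

locale unital_hom =
  fixes h :: "'a::comm_ring_1 \<Rightarrow> 'b::comm_ring_1"
  assumes add: "h (x + y) = h x + h y"
    and mult: "h (x * y) = h x * h y"
    and one: "h 1 = 1"
begin

lemma zero: "h 0 = 0"
  using add[of 0 0] by simp

lemma uminus: "h (- x) = - h x"
  using add[of x "- x"] zero by (simp add: eq_neg_iff_add_eq_0 add.commute)

lemma diff: "h (x - y) = h x - h y"
  using add[of x "- y"] uminus[of y] by simp

lemma power: "h (x ^ n) = h x ^ n"
  by (induction n) (simp_all add: one mult)

lemma dvd: "x dvd y \<Longrightarrow> h x dvd h y"
  by (auto simp: dvd_def mult)

lemmas simps = add mult one zero uminus diff power

lemma unital_hom_map_poly: "unital_hom (map_poly h)"
proof
  show madd: "map_poly h (p + q) = map_poly h p + map_poly h q" for p q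
    by (intro poly_eqI) (simp add: coeff_map_poly zero add)
  have msmult: "map_poly h (smult c p) = smult (h c) (map_poly h p)" for c p
    by (simp add: map_poly_smult zero mult)
  show "map_poly h (p * q) = map_poly h p * map_poly h q" for p q
    by (induction p) (simp_all add: map_poly_pCons zero madd msmult)
  show "map_poly h 1 = 1"
    by (simp add: one)
qed

lemma unital_hom_eval: "unital_hom (\<lambda>p. poly (map_poly h p) u)"
proof -
  interpret m: unital_hom "map_poly h" by (rule unital_hom_map_poly)
  show ?thesis by unfold_locales (simp_all add: m.simps)
qed

lemma hom_poly: "h (poly p x) = poly (map_poly h p) (h x)"
  by (induction p) (simp_all add: map_poly_pCons simps)

end

lemma unital_hom_eval2:
  assumes "unital_hom e"
  shows "unital_hom (\<lambda>p. eval2 e p u v)"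
  unfolding eval2_def
  by (intro unital_hom.unital_hom_eval assms)

lemma eval2_simps:
  assumes "unital_hom e"
  shows "eval2 e (const2 c) u v = e c" "eval2 e X2 u v = u" "eval2 e Y2 u v = v"
proof -
  interpret e: unital_hom e by fact
  interpret i: unital_hom "\<lambda>c. poly (map_poly e c) u" by (rule e.unital_hom_eval)
  show "eval2 e (const2 c) u v = e c" "eval2 e X2 u v = u" "eval2 e Y2 u v = v"
    by (simp_all add: eval2_def const2_def X2_def Y2_def map_poly_pCons e.simps)
qed

lemma unital_hom_const2: "unital_hom (const2 :: 'a::comm_ring_1 \<Rightarrow> 'a bipoly)"
  by unfold_locales (simp_all add: const2_def one_pCons)

lemma unital_hom_to_fract: "unital_hom (to_fract :: 'a::idom \<Rightarrow> 'a fract)"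
  by unfold_locales simp_all

lemma unital_hom_const: "unital_hom (\<lambda>c::'a::comm_ring_1. [:c:])"
  by unfold_locales (simp_all add: one_pCons)

lemma unital_hom_to_ac: "unital_hom (to_ac :: 'a::field \<Rightarrow> 'a alg_closure)"
  by unfold_locales simp_all

lemma unital_hom_comp:
  assumes "unital_hom h" "unital_hom k"
  shows "unital_hom (\<lambda>x. h (k x))"
  using assms by (simp add: unital_hom_def)

text \<open>Constants and the two variables generate the polynomial ring. The rule serves for claims
  about generators that survive sums and products, such as clearing denominators.\<close>

lemma bipoly_induct [case_names const X Y add mult]:
  fixes p :: "'a::comm_ring_1 bipoly"
  assumes const: "\<And>c. P (const2 c)" and X: "P X2" and Y: "P Y2"
    and add: "\<And>p q. P p \<Longrightarrow> P q \<Longrightarrow> P (p + q)"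
    and mult: "\<And>p q. P p \<Longrightarrow> P q \<Longrightarrow> P (p * q)"
  shows "P p"
proof -
  have inner: "P [:c:]" for c :: "'a poly"
  proof (induction c)
    case 0
    show ?case using const[of 0] by (simp add: const2_def)
  next
    case (pCons a c)
    have "[:pCons a c:] = const2 a + X2 * [:c:]"
      by (simp add: const2_def X2_def)
    then show ?case using add[OF const mult[OF X pCons(2)]] by simp
  qed
  show ?thesis
  proof (induction p)
    case 0
    show ?case using inner[of 0] by simp
  next
    case (pCons a p)
    have "pCons a p = [:a:] + Y2 * p"
      by (simp add: Y2_def)
    then show ?case using add[OF inner mult[OF Y pCons(2)]] by simp
  qed
qed

lemma dvd_diff_power:
  fixes a b :: "'a::comm_ring_1"
  assumes "g dvd a - b"
  shows "g dvd a ^ n - b ^ n"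
  using assms by (metis dvd_mult2 power_diff_sumr2)

lemma dvd_diff_mult:
  fixes a b :: "'a::comm_ring_1"
  assumes "g dvd a - b" "g dvd c - d"
  shows "g dvd a * c - b * d"
proof -
  have "a * c - b * d = (a - b) * c + b * (c - d)" by (simp add: algebra_simps)
  then show ?thesis using assms by simp
qed

section \<open>The curve attached to a polynomial and its coordinate ring\<close>

text \<open>With \<open>X2\<close> as X and \<open>Y2\<close> as W, this is the relation c0 Z = 1 -
  c1 X + X^n W solved for Z.\<close>

definition Zpol :: "nat \<Rightarrow> 'a::field \<Rightarrow> 'a \<Rightarrow> 'a bipoly" where
  "Zpol n c0 c1 = const2 (inverse c0) * (1 - const2 c1 * X2 + X2 ^ n * Y2)"

definition curve :: "nat \<Rightarrow> 'a::field \<Rightarrow> 'a \<Rightarrow> 'a \<Rightarrow> 'a \<Rightarrow> 'a bipoly" where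
  "curve n c0 c1 e1 e0 = Zpol n c0 c1 ^ n * Y2 + const2 e1 * Zpol n c0 c1 + const2 e0 * X2"

definition param_poly :: "nat \<Rightarrow> 'a::field \<Rightarrow> 'a \<Rightarrow> 'a \<Rightarrow> 'a \<Rightarrow> 'a poly" where
  "param_poly n c0 c1 e1 e0 = [:c0, c1:] + [:0, 1:] ^ n * [:e1, e0:]"

locale param_curve =
  fixes n :: nat and c0 c1 e1 e0 :: "'a::field"
  assumes n: "n > 0" and c0: "c0 \<noteq> 0" and e0: "e0 \<noteq> 0"
begin

abbreviation "Z \<equiv> Zpol n c0 c1"
abbreviation "g \<equiv> curve n c0 c1 e1 e0"
abbreviation "f \<equiv> param_poly n c0 c1 e1 e0"

text \<open>On the curve, \<open>tau\<close> restricts to the parameter \<open>t\<close>, and \<open>ftau\<close> to \<open>f(t)\<close>.\<close>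

definition tau :: "'a bipoly" where
  "tau = - const2 (inverse e0) * (Z ^ (n - 1) * Y2 + const2 e1)"

definition ftau :: "'a bipoly" where
  "ftau = const2 c0 + const2 c1 * tau + tau ^ n * (const2 e1 + const2 e0 * tau)"

sublocale const2: unital_hom "const2 :: 'a \<Rightarrow> 'a bipoly" by (rule unital_hom_const2)

lemma Z_eq: "const2 c0 * Z = 1 - const2 c1 * X2 + X2 ^ n * Y2"
  unfolding Zpol_def mult.assoc[symmetric] const2.mult[symmetric] using c0 by (simp add: const2.simps)

lemma tau_eq: "const2 e1 + const2 e0 * tau = - (Z ^ (n - 1) * Y2)"
proof -
  have "const2 e0 * tau = - (const2 (e0 * inverse e0) * (Z ^ (n - 1) * Y2 + const2 e1))"
    unfolding tau_def const2.mult by simp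
  then show ?thesis using e0 by (simp add: const2.simps)
qed

lemma Z_power: "Z ^ n = Z * Z ^ (n - 1)"
  using n by (cases n) simp_all

text \<open>Putting X = Z t into the equation of the curve and dividing by Z gives Z^(n-1) W + e1 +
  e0 t = 0, which \<open>tau\<close> solves for t. Hence e0 (X - Z tau) is exactly
  \<open>g\<close>.\<close>

lemma dvd_X: "g dvd X2 - Z * tau"
proof -
  have "const2 e0 * (X2 - Z * tau) = const2 e0 * X2 - Z * (const2 e0 * tau)"
    by (simp add: algebra_simps)
  also have "const2 e0 * tau = - (Z ^ (n - 1) * Y2) - const2 e1"
    using tau_eq by (simp add: algebra_simps)
  also have "const2 e0 * X2 - Z * (- (Z ^ (n - 1) * Y2) - const2 e1) = g"
    unfolding curve_def Z_power by (simp add: algebra_simps)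
  finally have "const2 (inverse e0) * g = const2 (inverse e0 * e0) * (X2 - Z * tau)"
    unfolding const2.mult by (metis mult.assoc)
  then have "X2 - Z * tau = g * const2 (inverse e0)" using e0 by (simp add: const2.simps mult.commute)
  then show ?thesis by (rule dvdI)
qed

text \<open>Replacing Z tau by X in Z f(tau) leaves c0 Z + c1 X - X^n W, which is 1 by
  \<open>Z_eq\<close>. So \<open>Z\<close> inverts \<open>ftau\<close> on the curve.\<close>

lemma dvd_Z: "g dvd Z * ftau - 1"
proof -
  have "Z * ftau = const2 c0 * Z + const2 c1 * (Z * tau) + tau ^ n * (Z * (const2 e1 + const2 e0 * tau))"
    unfolding ftau_def by (simp add: algebra_simps)
  also have "Z * (const2 e1 + const2 e0 * tau) = - (Z ^ n * Y2)"
    unfolding tau_eq Z_power by simp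
  finally have "Z * ftau - 1 = - const2 c1 * (X2 - Z * tau) + Y2 * (X2 ^ n - (Z * tau) ^ n)"
    unfolding Z_eq power_mult_distrib by (simp add: algebra_simps)
  then show ?thesis using dvd_X dvd_diff_power[OF dvd_X, of n] by (metis dvd_add dvd_mult)
qed

text \<open>Multiply Z^(n-1) W = - (e1 + e0 tau) by \<open>ftau ^ (n - 1)\<close> and cancel with
  \<open>dvd_Z\<close>.\<close>

lemma dvd_Y: "g dvd Y2 + ftau ^ (n - 1) * (const2 e1 + const2 e0 * tau)"
proof -
  have "Y2 + ftau ^ (n - 1) * (const2 e1 + const2 e0 * tau) = - Y2 * ((Z * ftau) ^ (n - 1) - 1 ^ (n - 1))"
    unfolding tau_eq power_mult_distrib by (simp add: algebra_simps)
  then show ?thesis using dvd_diff_power[OF dvd_Z] by (metis dvd_mult)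
qed

end

section \<open>Parametrization of the curve by t\<close>

context param_curve
begin

abbreviation e :: "'a \<Rightarrow> 'a poly fract" where "e \<equiv> (\<lambda>c. to_fract [:c:])"

abbreviation at_tau :: "'a poly \<Rightarrow> 'a bipoly" where
  "at_tau h \<equiv> poly (map_poly const2 h) tau"

text \<open>Pullback along the parametrization of the curve by t. The images of X and W are read off
  from \<open>dvd_X\<close>, \<open>dvd_Z\<close> and \<open>dvd_Y\<close>; the kernel will turn out
  to be generated by \<open>g\<close>.\<close>

definition eta :: "'a bipoly \<Rightarrow> 'a poly fract" where
  "eta p = eval2 e p (to_fract [:0, 1:] / to_fract f) (- to_fract (f ^ (n - 1) * [:e1, e0:]))"

sublocale e: unital_hom e
  by (intro unital_hom_comp[OF unital_hom_to_fract unital_hom_const])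

sublocale frac: unital_hom "to_fract :: 'a poly \<Rightarrow> 'a poly fract"
  by (rule unital_hom_to_fract)

sublocale eta: unital_hom eta
  unfolding eta_def by (intro unital_hom_eval2 e.unital_hom_axioms)

sublocale at_tau: unital_hom at_tau
  by (rule const2.unital_hom_eval)

lemma eta_gens:
  "eta (const2 c) = e c" "eta X2 = to_fract [:0, 1:] / to_fract f"
  "eta Y2 = - to_fract (f ^ (n - 1) * [:e1, e0:])"
  unfolding eta_def by (simp_all only: eval2_simps[OF e.unital_hom_axioms])

lemma poly_f_0: "poly f 0 = c0"
  using n by (simp add: param_poly_def)

lemma f_nonzero: "f \<noteq> 0"
  using poly_f_0 c0 by auto

lemma eta_Z: "to_fract f * eta Z = 1"
proof -
  let ?f = "to_fract f" and ?t = "to_fract [:0, 1:] :: 'a poly fract" and ?E = "to_fract [:e1, e0:]"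
  have f0: "?f \<noteq> 0" using f_nonzero by simp
  have "eta (const2 c0 * Z) = 1 - e c1 * (?t / ?f) - (?t / ?f) ^ n * (?f ^ (n - 1) * ?E)"
    unfolding Z_eq eta.simps eta_gens by (simp add: frac.simps del: mult_pCons_right)
  then have "?f * (e c0 * eta Z) = ?f - e c1 * ?t - ?f * ((?t / ?f) ^ n * ?f ^ (n - 1)) * ?E"
    using f0 by (simp add: eta.simps eta_gens right_diff_distrib mult.assoc del: times_divide_eq_left)
  also have "?f * ((?t / ?f) ^ n * ?f ^ (n - 1)) = (?t / ?f) ^ n * ?f ^ n"
    using n by (cases n) simp_all
  also have "\<dots> = ?t ^ n"
    using f0 by (simp add: power_divide)
  also have "?f - e c1 * ?t - ?t ^ n * ?E = to_fract (f - [:c1:] * [:0, 1:] - [:0, 1:] ^ n * [:e1, e0:])"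
    by (simp only: frac.simps)
  also have "f - [:c1:] * [:0, 1:] - [:0, 1:] ^ n * [:e1, e0:] = [:c0:]"
    by (simp add: param_poly_def)
  finally have "e c0 * (?f * eta Z) = e c0 * 1" by (simp add: mult_ac)
  then show ?thesis using c0 by simp
qed

lemma eta_g: "eta g = 0"
proof -
  let ?f = "to_fract f" and ?t = "to_fract [:0, 1:] :: 'a poly fract" and ?E = "to_fract [:e1, e0:]"
  have f0: "?f \<noteq> 0" using f_nonzero by simp
  have Z: "eta Z = 1 / ?f" using eta_Z f0 by (simp add: field_simps)
  have "(1 / ?f) ^ n * (?f ^ (n - 1) * y) = y / ?f" for y
    using n f0 by (cases n) (simp_all add: power_divide)
  then have "eta g = - (1 / ?f) * ?E + e e1 * (1 / ?f) + e e0 * (?t / ?f)"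
    unfolding curve_def eta.simps eta_gens Z by (simp add: frac.simps del: mult_pCons_right)
  also have "?E = e e1 + e e0 * ?t"
    by (simp flip: to_fract_add to_fract_mult)
  finally show ?thesis by (simp add: divide_inverse algebra_simps)
qed

lemma eta_eq:
  assumes "g dvd p - q"
  shows "eta p = eta q"
  using eta.dvd[OF assms] by (simp add: eta_g eta.diff)

lemma ftau_eq: "ftau = at_tau f"
  unfolding ftau_def param_poly_def at_tau.simps by (simp add: map_poly_pCons const2.zero const2.one mult.commute)

lemma eta_tau: "eta tau = to_fract [:0, 1:]"
proof -
  have "to_fract [:0, 1:] / to_fract f = eta Z * eta tau"
    using eta_eq[OF dvd_X] by (simp add: eta.simps eta_gens)
  then have "to_fract f * (to_fract [:0, 1:] / to_fract f) = (to_fract f * eta Z) * eta tau" by simp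
  then show ?thesis using f_nonzero by (simp add: eta_Z)
qed

lemma unital_hom_at_tau:
  assumes "unital_hom \<psi>"
  shows "\<psi> (at_tau h) = poly (map_poly (\<lambda>c. \<psi> (const2 c)) h) (\<psi> tau)"
proof -
  interpret unital_hom \<psi> by fact
  show ?thesis
    unfolding hom_poly by (simp add: map_poly_map_poly zero const2.zero o_def)
qed

lemma poly_map_e_t: "poly (map_poly e h) (to_fract [:0, 1:]) = to_fract h"
proof (induction h)
  case (pCons a h)
  have "pCons a h = [:a:] + [:0, 1:] * h" by simp
  then show ?case using pCons by (simp add: map_poly_pCons e.zero flip: to_fract_add to_fract_mult)
qed simp

lemma eta_at_tau: "eta (at_tau h) = to_fract h"
  unfolding unital_hom_at_tau[OF eta.unital_hom_axioms] eta_gens eta_tau by (rule poly_map_e_t)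

text \<open>Modulo \<open>g\<close>, both variables are polynomials in \<open>tau\<close> and the
  inverse of \<open>ftau\<close>, so a power of \<open>ftau\<close> clears all denominators.\<close>

lemma clear_denominators: "\<exists>N h. g dvd ftau ^ N * p - at_tau h"
proof (induction p rule: bipoly_induct)
  case (const c)
  have "g dvd ftau ^ 0 * const2 c - at_tau [:c:]" by (simp add: map_poly_pCons const2.zero)
  then show ?case by blast
next
  case X
  have "ftau ^ 1 * X2 - at_tau [:0, 1:] = ftau * (X2 - Z * tau) + tau * (Z * ftau - 1)"
    by (simp add: map_poly_pCons const2.simps algebra_simps)
  then have "g dvd ftau ^ 1 * X2 - at_tau [:0, 1:]" using dvd_X dvd_Z by (metis dvd_add dvd_mult)
  then show ?case by blast
next
  case Y
  have "at_tau (- (f ^ (n - 1) * [:e1, e0:])) = - (ftau ^ (n - 1) * (const2 e1 + const2 e0 * tau))"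
    unfolding at_tau.simps ftau_eq by (simp add: map_poly_pCons const2.simps mult.commute del: mult_pCons_right)
  then have "g dvd ftau ^ 0 * Y2 - at_tau (- (f ^ (n - 1) * [:e1, e0:]))" using dvd_Y by simp
  then show ?case by blast
next
  case (add p q)
  then obtain N h M k where h: "g dvd ftau ^ N * p - at_tau h" and k: "g dvd ftau ^ M * q - at_tau k"
    by blast
  have "ftau ^ (N + M) * (p + q) - at_tau (f ^ M * h + f ^ N * k)
    = ftau ^ M * (ftau ^ N * p - at_tau h) + ftau ^ N * (ftau ^ M * q - at_tau k)"
    by (simp add: at_tau.simps flip: ftau_eq) (simp add: algebra_simps power_add)
  then show ?case using h k by (metis dvd_add dvd_mult)
next
  case (mult p q)
  then obtain N h M k where h: "g dvd ftau ^ N * p - at_tau h" and k: "g dvd ftau ^ M * q - at_tau k"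
    by blast
  have "ftau ^ (N + M) * (p * q) - at_tau (h * k) = ftau ^ N * p * (ftau ^ M * q) - at_tau h * at_tau k"
    by (simp add: at_tau.simps algebra_simps power_add)
  then show ?case using dvd_diff_mult[OF h k] by metis
qed

lemma eta_image: "\<exists>N h. to_fract f ^ N * eta p = to_fract h"
proof -
  obtain N h where "g dvd ftau ^ N * p - at_tau h" using clear_denominators by blast
  then have "to_fract f ^ N * eta p = to_fract h"
    using eta_eq by (metis eta.mult eta.power eta_at_tau ftau_eq)
  then show ?thesis by blast
qed

text \<open>After clearing denominators p becomes h(tau), and \<open>eta\<close> sends this to h, so
  h = 0. The power of \<open>ftau\<close> is then removed with its inverse \<open>Z\<close> modulo
  \<open>g\<close>.\<close>

lemma eta_eq_0_iff: "eta p = 0 \<longleftrightarrow> g dvd p"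
proof
  assume p: "eta p = 0"
  obtain N h where h: "g dvd ftau ^ N * p - at_tau h" using clear_denominators by blast
  have "to_fract f ^ N * eta p = to_fract h"
    using eta_eq[OF h] by (metis eta.mult eta.power eta_at_tau ftau_eq)
  with p have "h = 0" by simp
  with h have "g dvd ftau ^ N * p" by simp
  then have "g dvd (Z * ftau) ^ N * p"
    by (simp add: power_mult_distrib mult.assoc)
  moreover have "(Z * ftau) ^ N * p = ((Z * ftau) ^ N - 1 ^ N) * p + p"
    by (simp add: algebra_simps)
  ultimately show "g dvd p"
    using dvd_diff_power[OF dvd_Z, of N] by (metis dvd_add_right_iff dvd_mult2)
next
  assume "g dvd p"
  then show "eta p = 0" using eta_eq[of p 0] by (simp add: eta.simps)
qed

section \<open>Top coefficient and primality of the curve equation\<close>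

lemma Z_list: "Z = [:[:inverse c0:] * (1 - [:0, c1:]), [:inverse c0:] * [:0, 1:] ^ n:]"
proof -
  have "[:[:0, 1:]:] ^ n = [:[:0, 1:] ^ n :: 'a poly:]"
    by (induction n) (simp_all add: one_pCons)
  then show ?thesis by (simp add: Zpol_def const2_def X2_def Y2_def one_pCons)
qed

lemma degree_Z: "degree Z = 1" and lead_coeff_Z: "lead_coeff Z = [:inverse c0:] * [:0, 1:] ^ n"
  unfolding Z_list using c0 by simp_all

text \<open>Only Z^n W reaches degree n + 1 in W, and its leading coefficient there is a nonzero
  multiple of X^(n^2). This gives both that \<open>g\<close> is nonzero and that its degree bound is
  attained.\<close>

lemma coeff_g_top: "coeff (coeff g (n + 1)) (n * n) \<noteq> 0"
proof -
  have Z0: "Z \<noteq> 0" using degree_Z by auto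
  have deg: "degree (Z ^ n * Y2) = n + 1"
    using Z0 by (simp add: degree_mult_eq degree_power_eq degree_Z Y2_def)
  have lc: "lead_coeff (Z ^ n * Y2) = ([:inverse c0:] * [:0, 1:] ^ n) ^ n"
    unfolding lead_coeff_mult lead_coeff_power lead_coeff_Z by (simp add: Y2_def)
  have "coeff Z (n + 1) = 0"
    using n by (intro coeff_eq_0) (simp add: degree_Z)
  then have "coeff g (n + 1) = coeff (Z ^ n * Y2) (n + 1)"
    using n by (simp add: curve_def const2_def X2_def coeff_pCons split: nat.splits)
  also have "\<dots> = ([:inverse c0:] * [:0, 1:] ^ n) ^ n"
    using lc deg by simp
  also have "\<dots> = smult (inverse c0 ^ n) (monom 1 (n * n))"
    by (simp add: smult_power monom_altdef flip: power_mult)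
  finally show ?thesis using c0 by simp
qed

text \<open>By \<open>eta_eq_0_iff\<close> the quotient by \<open>g\<close> embeds into the field
  k(t), so it is a domain.\<close>

lemma prime_elem_g: "prime_elem g"
proof (rule prime_elemI)
  show "g \<noteq> 0" using coeff_g_top by auto
  show "\<not> is_unit g"
    by (simp flip: eta_eq_0_iff add: eta.one)
  show "g dvd p \<or> g dvd q" if "g dvd p * q" for p q
    using that by (simp flip: eta_eq_0_iff add: eta.mult)
qed

end

lemma map_poly_curve:
  assumes "unital_hom h" "h (inverse c0) = inverse (h c0)"
  shows "map_poly (map_poly h) (curve n c0 c1 e1 e0) = curve n (h c0) (h c1) (h e1) (h e0)"
proof -
  interpret h: unital_hom h by fact
  interpret m: unital_hom "map_poly h" by (rule h.unital_hom_map_poly)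
  interpret mm: unital_hom "map_poly (map_poly h)" by (rule m.unital_hom_map_poly)
  have "map_poly (map_poly h) (const2 c) = const2 (h c)" for c
    by (simp add: const2_def map_poly_pCons h.zero)
  moreover have "map_poly (map_poly h) X2 = X2" "map_poly (map_poly h) Y2 = Y2"
    by (simp_all add: X2_def Y2_def map_poly_pCons h.simps m.simps)
  ultimately show ?thesis by (simp add: curve_def Zpol_def mm.simps assms(2))
qed

text \<open>The construction commutes with extension of the field, and primality holds over every
  field, in particular over the algebraic closure.\<close>

lemma geom_irreducible_curve:
  assumes "param_curve n c0 e0"
  shows "geom_irreducible (curve n c0 c1 e1 e0)"
proof -
  interpret param_curve n c0 c1 e1 e0 by fact
  interpret ac: param_curve n "to_ac c0" "to_ac c1" "to_ac e1" "to_ac e0"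
    by unfold_locales (use n c0 e0 in auto)
  show ?thesis
    unfolding geom_irreducible_def map_poly_curve[OF unital_hom_to_ac to_ac_inverse]
    by (intro prime_elem_imp_irreducible ac.prime_elem_g)
qed

section \<open>Total degree\<close>

text \<open>An upper bound passes through sums and products without regard to cancellation; the
  exact degree then needs just one nonzero coefficient.\<close>

definition degree2_le :: "nat \<Rightarrow> 'a::zero bipoly \<Rightarrow> bool" where
  "degree2_le m p \<longleftrightarrow> (\<forall>i j. coeff (coeff p j) i \<noteq> 0 \<longrightarrow> i + j \<le> m)"

lemma degree2_le_mono: "degree2_le m p \<Longrightarrow> m \<le> m' \<Longrightarrow> degree2_le m' p"
  unfolding degree2_le_def by (meson le_trans)

lemma degree2_le_add: "degree2_le m p \<Longrightarrow> degree2_le m q \<Longrightarrow> degree2_le m (p + q)"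
  for p q :: "'a::comm_ring_1 bipoly"
  unfolding degree2_le_def by (metis add.right_neutral add_cancel_left_left coeff_add)

lemma degree2_le_mult: "degree2_le m p \<Longrightarrow> degree2_le k q \<Longrightarrow> degree2_le (m + k) (p * q)"
  for p q :: "'a::comm_ring_1 bipoly"
proof -
  assume p: "degree2_le m p" and q: "degree2_le k q"
  show ?thesis
    unfolding degree2_le_def
  proof (intro allI impI)
    fix i j
    assume "coeff (coeff (p * q) j) i \<noteq> 0"
    then obtain j' where j': "j' \<le> j" "coeff (coeff p j' * coeff q (j - j')) i \<noteq> 0"
      unfolding coeff_mult[of p] coeff_sum by (meson atMost_iff sum.neutral)
    then obtain i' where i': "i' \<le> i" "coeff (coeff p j') i' * coeff (coeff q (j - j')) (i - i') \<noteq> 0"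
      unfolding coeff_mult by (meson atMost_iff sum.neutral)
    then have "coeff (coeff p j') i' \<noteq> 0" "coeff (coeff q (j - j')) (i - i') \<noteq> 0"
      by auto
    then have "i' + j' \<le> m" "i - i' + (j - j') \<le> k"
      using p q unfolding degree2_le_def by blast+
    then show "i + j \<le> m + k" using i' j' by linarith
  qed
qed

lemma degree2_le_gens:
  "degree2_le m (const2 c)" "degree2_le 1 (X2 :: 'a::comm_ring_1 bipoly)" "degree2_le 1 (Y2 :: 'a bipoly)"
  "degree2_le m (1 :: 'a bipoly)"
  by (auto simp: degree2_le_def const2_def X2_def Y2_def one_pCons coeff_pCons split: nat.splits if_splits)

lemma degree2_le_power: "degree2_le m p \<Longrightarrow> degree2_le (k * m) (p ^ k)"
  for p :: "'a::comm_ring_1 bipoly"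
  by (induction k) (auto intro: degree2_le_gens degree2_le_mult)

lemma degree2_le_uminus: "degree2_le m p \<Longrightarrow> degree2_le m (- p)"
  for p :: "'a::comm_ring_1 bipoly"
  by (simp add: degree2_le_def)

lemma total_degree_eqI:
  assumes "degree2_le m p" "coeff (coeff p j) i \<noteq> 0" "i + j = m"
  shows "total_degree p = m"
  unfolding total_degree_def
proof (rule Max_eqI)
  show "finite {i + j |i j. coeff (coeff p j) i \<noteq> 0}"
    by (rule finite_subset[of _ "{..m}"]) (use assms(1) in \<open>auto simp: degree2_le_def\<close>)
qed (use assms in \<open>auto simp: degree2_le_def\<close>)

context param_curve
begin

text \<open>The bound n + 1 for \<open>Z\<close> gives n (n + 1) + 1 for Z^n W, and the monomial
  X^(n^2) W^(n+1) attains it. For n = 2 and n = 3 this is 7 and 13.\<close>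

lemma total_degree_g: "total_degree g = n * n + n + 1"
proof (rule total_degree_eqI)
  have "degree2_le (n + 1) (X2 ^ n * Y2 :: 'a bipoly)"
    using degree2_le_mult[OF degree2_le_power[OF degree2_le_gens(2), of n] degree2_le_gens(3)] by simp
  moreover have "degree2_le (n + 1) (const2 c1 * X2)"
    using degree2_le_mult[OF degree2_le_gens(1)[of n] degree2_le_gens(2)] by simp
  ultimately have "degree2_le (n + 1) (1 + - (const2 c1 * X2) + X2 ^ n * Y2)"
    by (intro degree2_le_add degree2_le_uminus degree2_le_gens)
  then have Z: "degree2_le (n + 1) Z"
    unfolding Zpol_def using degree2_le_mult[OF degree2_le_gens(1)[of 0]] by fastforce
  have "degree2_le (n * n + n + 1) (Z ^ n * Y2)"
    using degree2_le_mult[OF degree2_le_power[OF Z, of n] degree2_le_gens(3)] by (simp add: algebra_simps)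
  moreover have "degree2_le (n * n + n + 1) (const2 e1 * Z)"
    by (rule degree2_le_mono[OF degree2_le_mult[OF degree2_le_gens(1)[of 0] Z]]) simp
  moreover have "degree2_le (n * n + n + 1) (const2 e0 * X2)"
    by (rule degree2_le_mono[OF degree2_le_mult[OF degree2_le_gens(1)[of 0] degree2_le_gens(2)]]) simp
  ultimately show "degree2_le (n * n + n + 1) g"
    unfolding curve_def by (intro degree2_le_add)
  show "coeff (coeff g (n + 1)) (n * n) \<noteq> 0" by (rule coeff_g_top)
qed simp

end

section \<open>Isomorphic complements\<close>

text \<open>Since \<open>h\<close> sends \<open>g1\<close> to a unit of the second localization, it
  extends to the first one, and likewise \<open>k\<close>. Assumption \<open>hk\<close> says that
  the extension of \<open>k\<close> takes \<open>h p\<close> back to p, and \<open>kh\<close> is the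
  same in the other order.\<close>

lemma complements_isomorphicI:
  fixes g1 g2 :: "'a::field bipoly"
  assumes g1: "g1 \<noteq> 0" and g2: "g2 \<noteq> 0"
    and h: "unital_hom h" "\<And>c. h (const2 c) = to_fract (const2 c)"
    and k: "unital_hom k" "\<And>c. k (const2 c) = to_fract (const2 c)"
    and hg: "h g1 = 1 / to_fract g2" and kg: "k g2 = 1 / to_fract g1"
    and hk: "\<And>p. \<exists>q m. h p * to_fract g2 ^ m = to_fract q \<and> k q * to_fract g1 ^ m = to_fract p"
    and kh: "\<And>p. \<exists>q m. k p * to_fract g1 ^ m = to_fract q \<and> h q * to_fract g2 ^ m = to_fract p"
  shows "complements_isomorphic g1 g2"
proof -
  interpret h: unital_hom h by fact
  interpret k: unital_hom k by fact
  let ?f = "to_fract :: 'a bipoly \<Rightarrow> _"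
  interpret f: unital_hom ?f by (rule unital_hom_to_fract)
  have f1: "?f g1 \<noteq> 0" and f2: "?f g2 \<noteq> 0" using g1 g2 by simp_all
  \<comment> \<open>The extension sends P / g^n to h(P) g'^n, because h(g) = 1/g'. The next step
    shows that this is independent of the chosen fraction.\<close>
  define ext :: "('a bipoly \<Rightarrow> 'a bipoly fract) \<Rightarrow> 'a bipoly \<Rightarrow> 'a bipoly \<Rightarrow> 'a bipoly fract \<Rightarrow> 'a bipoly fract"
    where "ext = (\<lambda>h g g' u. THE w. \<exists>P n. u = ?f P / ?f g ^ n \<and> w = h P * ?f g' ^ n)"
  have ext: "ext h g g' (?f P / ?f g ^ n) = h P * ?f g' ^ n"
    if h: "unital_hom h" and g: "?f g \<noteq> 0" and g': "?f g' \<noteq> 0" and hg: "h g = 1 / ?f g'" for h g g' P n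
  proof -
    interpret h: unital_hom h by fact
    show ?thesis
      unfolding ext_def
    proof (rule the_equality)
      fix w
      assume "\<exists>Q m. ?f P / ?f g ^ n = ?f Q / ?f g ^ m \<and> w = h Q * ?f g' ^ m"
      then obtain Q m where eq: "?f P / ?f g ^ n = ?f Q / ?f g ^ m" and w: "w = h Q * ?f g' ^ m"
        by blast
      then have "?f (P * g ^ m) = ?f (Q * g ^ n)"
        using g by (simp add: f.power frac_eq_eq)
      then have "P * g ^ m = Q * g ^ n" by (simp only: to_fract_eq_iff)
      then have "h (P * g ^ m) = h (Q * g ^ n)" by simp
      then have "h P / ?f g' ^ m = h Q / ?f g' ^ n"
        by (simp add: h.simps hg power_divide)
      then show "w = h P * ?f g' ^ n"
        using g' w by (simp add: frac_eq_eq)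
    qed blast
  qed
  note exth = ext[OF h(1) f1 f2 hg] and extk = ext[OF k(1) f2 f1 kg]
  have mem: "?f P / ?f g ^ n \<in> loc_ring g" for P g n
    unfolding loc_ring_def by blast
  have "h p \<in> loc_ring g2" for p
  proof -
    obtain q m where "h p * ?f g2 ^ m = ?f q" using hk by blast
    then have "h p = ?f q / ?f g2 ^ m" using f2 by (simp add: field_simps)
    then show ?thesis using mem by simp
  qed
  moreover have "k p \<in> loc_ring g1" for p
  proof -
    obtain q m where "k p * ?f g1 ^ m = ?f q" using kh by blast
    then have "k p = ?f q / ?f g1 ^ m" using f1 by (simp add: field_simps)
    then show ?thesis using mem by simp
  qed
  moreover have "u * ?f g ^ m \<in> loc_ring g" if mem_u: "u \<in> loc_ring g" for u g m
  proof -
    obtain P n where "u = ?f P / ?f g ^ n" using mem_u unfolding loc_ring_def by blast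
    then have "u * ?f g ^ m = ?f (P * g ^ m) / ?f g ^ n" by (simp add: f.power)
    then show ?thesis using mem by metis
  qed
  ultimately have range: "h p * ?f g2 ^ m \<in> loc_ring g2" "k p * ?f g1 ^ m \<in> loc_ring g1" for p m
    by blast+
  have "bij_betw (ext h g1 g2) (loc_ring g1) (loc_ring g2)"
  proof (rule bij_betw_byWitness[where f' = "ext k g2 g1"])
    show "\<forall>u\<in>loc_ring g1. ext k g2 g1 (ext h g1 g2 u) = u"
    proof
      fix u assume "u \<in> loc_ring g1"
      then obtain P n where u: "u = ?f P / ?f g1 ^ n" unfolding loc_ring_def by blast
      obtain Q m where "h P * ?f g2 ^ m = ?f Q" and kQ: "k Q * ?f g1 ^ m = ?f P" using hk by blast
      then have Q: "h P = ?f Q / ?f g2 ^ m" using f2 by (simp add: field_simps)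
      have "ext h g1 g2 u = ?f (Q * g2 ^ n) / ?f g2 ^ m"
        unfolding u exth Q by (simp add: f.power)
      then have "ext k g2 g1 (ext h g1 g2 u) = k (Q * g2 ^ n) * ?f g1 ^ m"
        by (simp only: extk)
      also have "\<dots> = k Q * ?f g1 ^ m / ?f g1 ^ n"
        by (simp add: k.simps kg power_divide)
      finally show "ext k g2 g1 (ext h g1 g2 u) = u"
        using kQ u by simp
    qed
    show "\<forall>u\<in>loc_ring g2. ext h g1 g2 (ext k g2 g1 u) = u"
    proof
      fix u assume "u \<in> loc_ring g2"
      then obtain P n where u: "u = ?f P / ?f g2 ^ n" unfolding loc_ring_def by blast
      obtain Q m where "k P * ?f g1 ^ m = ?f Q" and hQ: "h Q * ?f g2 ^ m = ?f P" using kh by blast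
      then have Q: "k P = ?f Q / ?f g1 ^ m" using f1 by (simp add: field_simps)
      have "ext k g2 g1 u = ?f (Q * g1 ^ n) / ?f g1 ^ m"
        unfolding u extk Q by (simp add: f.power)
      then have "ext h g1 g2 (ext k g2 g1 u) = h (Q * g1 ^ n) * ?f g2 ^ m"
        by (simp only: exth)
      also have "\<dots> = h Q * ?f g2 ^ m / ?f g2 ^ n"
        by (simp add: h.simps hg power_divide)
      finally show "ext h g1 g2 (ext k g2 g1 u) = u"
        using hQ u by simp
    qed
    show "ext h g1 g2 ` loc_ring g1 \<subseteq> loc_ring g2"
      using exth range by (auto simp: loc_ring_def[of g1])
    show "ext k g2 g1 ` loc_ring g2 \<subseteq> loc_ring g1"
      using extk range by (auto simp: loc_ring_def[of g2])
  qed
  moreover have "ext h g1 g2 (u + v) = ext h g1 g2 u + ext h g1 g2 v \<and>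
    ext h g1 g2 (u * v) = ext h g1 g2 u * ext h g1 g2 v"
    if mem_uv: "u \<in> loc_ring g1" "v \<in> loc_ring g1" for u v
  proof -
    obtain P n Q m where u: "u = ?f P / ?f g1 ^ n" and v: "v = ?f Q / ?f g1 ^ m"
      using mem_uv unfolding loc_ring_def by blast
    have "u + v = ?f (P * g1 ^ m + Q * g1 ^ n) / ?f g1 ^ (n + m)"
      using f1 unfolding u v by (simp add: f.power power_add field_simps)
    moreover have "u * v = ?f (P * Q) / ?f g1 ^ (n + m)"
      unfolding u v by (simp add: power_add)
    moreover have "h (P * g1 ^ m + Q * g1 ^ n) * ?f g2 ^ (n + m) = h P * ?f g2 ^ n + h Q * ?f g2 ^ m"
      using f2 by (simp add: h.simps hg power_add power_divide field_simps)
    moreover have "h (P * Q) * ?f g2 ^ (n + m) = h P * ?f g2 ^ n * (h Q * ?f g2 ^ m)"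
      by (simp add: h.mult power_add mult_ac)
    ultimately show ?thesis
      unfolding u v by (simp only: exth)
  qed
  moreover have "ext h g1 g2 (to_fract (const2 c)) = to_fract (const2 c)" for c
    using exth[of "const2 c" 0] h(2) by simp
  ultimately show ?thesis unfolding complements_isomorphic_def by blast
qed

text \<open>Reading the coefficients backwards gives the reversed polynomial, so
  \<open>rev.g\<close> is the second curve.\<close>

locale param_curve_pair = param_curve n c0 c1 e1 e0
  for n :: nat and c0 c1 e1 e0 :: "'a::field"
begin

sublocale rev: param_curve n e0 e1 c1 c0
  by unfold_locales (use n c0 e0 in auto)

abbreviation K :: "'a \<Rightarrow> 'a bipoly fract" where "K \<equiv> (\<lambda>c. to_fract (const2 c))"

sublocale K: unital_hom K
  by (intro unital_hom_comp[OF unital_hom_to_fract unital_hom_const2])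

sublocale fract2: unital_hom "to_fract :: 'a bipoly \<Rightarrow> 'a bipoly fract"
  by (rule unital_hom_to_fract)

text \<open>In terms of the coordinates of the reversed curve, \<open>X = Z/g\<close> and \<open>Z = X/g\<close>.\<close>

definition transition :: "'a bipoly \<Rightarrow> 'a bipoly fract" where
  "transition p = eval2 K p (to_fract rev.Z / to_fract rev.g) (- to_fract (Y2 * rev.g ^ (n - 1)))"

sublocale transition: unital_hom transition
  unfolding transition_def by (intro unital_hom_eval2 K.unital_hom_axioms)

lemma transition_gens:
  "transition (const2 c) = K c" "transition X2 = to_fract rev.Z / to_fract rev.g"
  "transition Y2 = - to_fract (Y2 * rev.g ^ (n - 1))"
  unfolding transition_def by (simp_all only: eval2_simps[OF K.unital_hom_axioms])

lemma rev_g_nonzero: "to_fract rev.g \<noteq> 0"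
  using rev.prime_elem_g by (auto simp: prime_elem_def)

lemma rev_g_cancel: "(x / to_fract rev.g) ^ n * (to_fract rev.g ^ (n - 1) * y) = x ^ n * y / to_fract rev.g"
  using n rev_g_nonzero by (cases n) (simp_all add: power_divide)

text \<open>The equation defining \<open>rev.g\<close>, divided by \<open>rev.g\<close>, is the
  image of the relation \<open>Z_eq\<close>.\<close>

lemma transition_Z: "transition Z = to_fract X2 / to_fract rev.g"
proof -
  let ?f = "to_fract :: 'a bipoly \<Rightarrow> _"
  have "?f rev.g * transition (const2 c0 * Z) = ?f (rev.g - const2 c1 * rev.Z - rev.Z ^ n * Y2)"
    unfolding Z_eq transition.simps transition_gens
    using rev_g_nonzero rev_g_cancel[of "?f rev.Z" "?f Y2"]
    by (simp add: fract2.simps algebra_simps)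
  also have "rev.g - const2 c1 * rev.Z - rev.Z ^ n * Y2 = const2 c0 * X2"
    by (simp add: curve_def)
  finally have "K c0 * (?f rev.g * transition Z) = K c0 * ?f X2"
    by (simp add: transition.mult transition_gens mult_ac)
  moreover have "K c0 \<noteq> 0" using c0 by (simp add: const2_def)
  ultimately have "?f rev.g * transition Z = ?f X2" by simp
  then show ?thesis using rev_g_nonzero by (simp add: field_simps)
qed

text \<open>Conversely, the image of the equation defining \<open>g\<close>, multiplied by
  \<open>rev.g\<close>, is the relation \<open>rev.Z_eq\<close>.\<close>

lemma transition_g: "transition g = 1 / to_fract rev.g"
proof -
  let ?f = "to_fract :: 'a bipoly \<Rightarrow> _"
  have "?f rev.g * transition g = ?f (- (X2 ^ n * Y2) + const2 e1 * X2 + const2 e0 * rev.Z)"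
    unfolding curve_def[of n c0] transition.simps transition_gens transition_Z
    using rev_g_nonzero rev_g_cancel[of "?f X2" "?f Y2"]
    by (simp add: fract2.simps algebra_simps)
  also have "- (X2 ^ n * Y2) + const2 e1 * X2 + const2 e0 * rev.Z = 1"
    unfolding rev.Z_eq by simp
  finally show ?thesis using rev_g_nonzero by (simp add: field_simps)
qed

end

context param_curve_pair
begin

sublocale swap: param_curve_pair n e0 e1 c1 c0 ..

text \<open>Reversing twice restores the coefficients, so \<open>swap.transition\<close> goes back.
  On generators this exchanges X/g and Z/g; for sums and products the surplus powers of the curve
  equations cancel by \<open>gp\<close>.\<close>

lemma swap_transition:
  "\<exists>P m. transition p * to_fract rev.g ^ m = to_fract P \<and> swap.transition P * to_fract g ^ m = to_fract p"
proof -
  let ?f = "to_fract :: 'a bipoly \<Rightarrow> _"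
  have g0: "?f g \<noteq> 0" by (rule swap.rev_g_nonzero)
  have gi: "swap.transition rev.g * ?f g = 1" using g0 swap.transition_g by simp
  have gp: "swap.transition rev.g ^ k * ?f g ^ k = 1" for k
    by (metis gi power_mult_distrib power_one)
  show ?thesis
  proof (induction p rule: bipoly_induct)
    case (const c)
    show ?case by (intro exI[of _ "const2 c"] exI[of _ 0]) (simp add: transition_gens swap.transition_gens)
  next
    case X
    show ?case using rev_g_nonzero g0
      by (intro exI[of _ "rev.Z"] exI[of _ 1]) (simp add: transition_gens swap.transition_Z)
  next
    case Y
    have "swap.transition (- (Y2 * rev.g ^ (n - 1))) = ?f Y2 * (swap.transition rev.g ^ (n - 1) * ?f g ^ (n - 1))"
      by (simp add: swap.transition.simps swap.transition_gens fract2.simps mult_ac)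
    then show ?case unfolding gp
      by (intro exI[of _ "- (Y2 * rev.g ^ (n - 1))"] exI[of _ 0]) (simp add: transition_gens)
  next
    case (add p q)
    then obtain P m Q k where P: "transition p * ?f rev.g ^ m = ?f P" "swap.transition P * ?f g ^ m = ?f p"
      and Q: "transition q * ?f rev.g ^ k = ?f Q" "swap.transition Q * ?f g ^ k = ?f q" by blast
    have "transition (p + q) * ?f rev.g ^ (m + k)
      = transition p * ?f rev.g ^ m * ?f rev.g ^ k + transition q * ?f rev.g ^ k * ?f rev.g ^ m"
      by (simp add: transition.add power_add algebra_simps)
    also have "\<dots> = ?f (P * rev.g ^ k + Q * rev.g ^ m)"
      unfolding P Q by (simp add: fract2.simps)
    finally have 1: "transition (p + q) * ?f rev.g ^ (m + k) = ?f (P * rev.g ^ k + Q * rev.g ^ m)" .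
    have "swap.transition (P * rev.g ^ k + Q * rev.g ^ m) * ?f g ^ (m + k)
      = swap.transition P * ?f g ^ m * (swap.transition rev.g ^ k * ?f g ^ k)
        + swap.transition Q * ?f g ^ k * (swap.transition rev.g ^ m * ?f g ^ m)"
      by (simp add: swap.transition.simps power_add algebra_simps)
    also have "\<dots> = ?f (p + q)"
      unfolding gp P Q by simp
    finally show ?case using 1 by blast
  next
    case (mult p q)
    then obtain P m Q k where P: "transition p * ?f rev.g ^ m = ?f P" "swap.transition P * ?f g ^ m = ?f p"
      and Q: "transition q * ?f rev.g ^ k = ?f Q" "swap.transition Q * ?f g ^ k = ?f q" by blast
    have "transition (p * q) * ?f rev.g ^ (m + k)
      = transition p * ?f rev.g ^ m * (transition q * ?f rev.g ^ k)"
      by (simp add: transition.mult power_add mult_ac)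
    also have "\<dots> = ?f (P * Q)"
      unfolding P Q by simp
    finally have 1: "transition (p * q) * ?f rev.g ^ (m + k) = ?f (P * Q)" .
    have "swap.transition (P * Q) * ?f g ^ (m + k)
      = swap.transition P * ?f g ^ m * (swap.transition Q * ?f g ^ k)"
      by (simp add: swap.transition.mult power_add mult_ac)
    also have "\<dots> = ?f (p * q)"
      unfolding P Q by simp
    finally show ?case using 1 by blast
  qed
qed

end

lemma complements_isomorphic_curve:
  assumes "param_curve n c0 e0"
  shows "complements_isomorphic (curve n c0 c1 e1 e0) (curve n e0 e1 c1 c0)"
proof -
  interpret param_curve_pair n c0 c1 e1 e0
    using assms by (simp add: param_curve_pair_def)
  show ?thesis
  proof (rule complements_isomorphicI[where h = transition and k = swap.transition])
    show "curve n c0 c1 e1 e0 \<noteq> 0" "curve n e0 e1 c1 c0 \<noteq> 0"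
      using rev_g_nonzero swap.rev_g_nonzero by simp_all
  qed (rule transition.unital_hom_axioms swap.transition.unital_hom_axioms transition_gens
      swap.transition_gens transition_g swap.transition_g swap_transition swap.swap_transition)+
qed

section \<open>Excluding Moebius transformations\<close>

text \<open>The name \<open>algebra\<close> alone denotes a different proof method here, from HOL-Algebra. The Groebner basis
  method divides by numerals, which may vanish in the field, so cofactors are given explicitly.\<close>

lemma cubic_roots_vieta:
  fixes b :: "'k::field"
  assumes "b * x ^ 3 + x + 1 = 0" "b * y ^ 3 + y + 1 = 0" "b * z ^ 3 + z + 1 = 0"
    and "x \<noteq> y" "x \<noteq> z" "y \<noteq> z" "b \<noteq> 0"
  shows "x + y + z = 0" "b * (x * y + x * z + y * z) = 1" "b * (x * y * z) = - 1"
proof -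
  \<comment> \<open>Subtracting two root equations and cancelling the difference of the roots gives
    a divided difference. Repeating this with the divided differences leaves the sum of the
    roots.\<close>
  have "(x - y) * (b * (x ^ 2 + x * y + y ^ 2) + 1) = 0"
    using assms(1,2) by Groebner_Basis.algebra
  then have xy: "b * (x ^ 2 + x * y + y ^ 2) + 1 = 0" using assms by simp
  have "(x - z) * (b * (x ^ 2 + x * z + z ^ 2) + 1) = 0"
    using assms(1,3) by Groebner_Basis.algebra
  then have xz: "b * (x ^ 2 + x * z + z ^ 2) + 1 = 0" using assms by simp
  have "b * (y - z) * (x + y + z) = 0" using xy xz by Groebner_Basis.algebra
  then show s: "x + y + z = 0" using assms by simp
  show "b * (x * y + x * z + y * z) = 1" using s xy by Groebner_Basis.algebra
  show "b * (x * y * z) = - 1" using s xy assms(1) by Groebner_Basis.algebra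
qed

text \<open>The cubic has no square term, so two distinct roots x and y determine any further root
  as - (x + y).\<close>

lemma cubic_four_roots:
  fixes b :: "'k::field"
  assumes "b * x ^ 3 + x + 1 = 0" "b * y ^ 3 + y + 1 = 0" "b * z ^ 3 + z + 1 = 0" "b * w ^ 3 + w + 1 = 0"
    and "x \<noteq> y" "x \<noteq> z" "y \<noteq> z" "x \<noteq> w" "y \<noteq> w" "b \<noteq> 0"
  shows "z = w"
  using cubic_roots_vieta(1)[of b x y z] cubic_roots_vieta(1)[of b x y w] assms by (metis add_left_cancel)

text \<open>Here \<open>xi\<close> are the roots of \<open>b x^3 + x + 1\<close> and \<open>ai\<close> those of \<open>a^3 + a^2 + b\<close>.\<close>

lemma affine_match:
  fixes b :: "'k::field"
  assumes b: "b \<noteq> 0" "27 * b \<noteq> - 1" "27 * b \<noteq> - 4"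
    and x: "x1 + x2 + x3 = 0" "b * (x1 * x2 + x1 * x3 + x2 * x3) = 1" "b * (x1 * x2 * x3) = - 1"
    and a: "a1 + a2 + a3 = - 1" "a1 * a2 + a1 * a3 + a2 * a3 = 0" "a1 * a2 * a3 = - b"
    and ax: "a1 = \<alpha> * x1 + \<beta>" "a2 = \<alpha> * x2 + \<beta>" "a3 = \<alpha> * x3 + \<beta>"
  shows False
proof -
  \<comment> \<open>The three symmetric functions of the roots are compared in turn, starting with
    the sum.\<close>
  have \<beta>: "3 * \<beta> + 1 = 0" using a(1) x(1) unfolding ax by Groebner_Basis.algebra
  then have "\<beta> \<noteq> 0" by auto
  define q p where "q = x1 * x2 + x1 * x3 + x2 * x3" and "p = x1 * x2 * x3"
  have q: "b * q - 1 = 0" and p: "b * p + 1 = 0" using x unfolding q_def p_def by simp_all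
  have E2: "\<alpha> ^ 2 * q + 3 * \<beta> ^ 2 = 0"
    using a(2) x(1) unfolding ax q_def by Groebner_Basis.algebra
  have "\<alpha> ^ 2 - b * \<beta> = b * (\<alpha> ^ 2 * q + 3 * \<beta> ^ 2) - \<alpha> ^ 2 * (b * q - 1) - b * \<beta> * (3 * \<beta> + 1)"
    by Groebner_Basis.algebra
  then have \<alpha>: "\<alpha> ^ 2 - b * \<beta> = 0" unfolding E2 q \<beta> by simp
  have E3: "\<alpha> ^ 3 * p + \<alpha> ^ 2 * \<beta> * q + \<beta> ^ 3 + b = 0"
    using a(3) x(1) unfolding ax q_def p_def by Groebner_Basis.algebra
  have "b * (- \<alpha> * \<beta> + \<beta> ^ 2 + \<beta> ^ 3 + b) = b * (\<alpha> ^ 3 * p + \<alpha> ^ 2 * \<beta> * q + \<beta> ^ 3 + b)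
    - \<alpha> ^ 3 * (b * p + 1) - \<alpha> ^ 2 * \<beta> * (b * q - 1) + (\<alpha> - \<beta>) * (\<alpha> ^ 2 - b * \<beta>)"
    by Groebner_Basis.algebra
  then have "b * (- \<alpha> * \<beta> + \<beta> ^ 2 + \<beta> ^ 3 + b) = 0" unfolding E3 p q \<alpha> by simp
  then have C: "- \<alpha> * \<beta> + \<beta> ^ 2 + \<beta> ^ 3 + b = 0" using b by simp
  \<comment> \<open>Eliminating b leaves a quadratic in \<alpha> that splits. With 3 \<beta> = - 1
    the first factor leads to 27 b = - 4 and the second to 27 b = - 1.\<close>
  have "(\<alpha> - 2 * \<beta> ^ 2) * (\<alpha> + \<beta> ^ 2)
    = (\<alpha> ^ 2 - b * \<beta>) + \<beta> * (- \<alpha> * \<beta> + \<beta> ^ 2 + \<beta> ^ 3 + b) - \<beta> ^ 3 * (3 * \<beta> + 1)"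
    by Groebner_Basis.algebra
  then have "(\<alpha> - 2 * \<beta> ^ 2) * (\<alpha> + \<beta> ^ 2) = 0" unfolding C \<alpha> \<beta> by simp
  then consider "\<alpha> - 2 * \<beta> ^ 2 = 0" | "\<alpha> + \<beta> ^ 2 = 0" by (meson mult_eq_0_iff)
  then show False
  proof cases
    case 1
    have "\<beta> * (b - 4 * \<beta> ^ 3) = (\<alpha> - 2 * \<beta> ^ 2) * (\<alpha> + 2 * \<beta> ^ 2) - (\<alpha> ^ 2 - b * \<beta>)"
      by Groebner_Basis.algebra
    then have "\<beta> * (b - 4 * \<beta> ^ 3) = 0" unfolding 1 \<alpha> by simp
    then have b4: "b - 4 * \<beta> ^ 3 = 0" using \<open>\<beta> \<noteq> 0\<close> by simp
    have "27 * b + 4 = 27 * (b - 4 * \<beta> ^ 3) + 4 * (9 * \<beta> ^ 2 - 3 * \<beta> + 1) * (3 * \<beta> + 1)"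
      by Groebner_Basis.algebra
    then have "27 * b + 4 = 0" unfolding b4 \<beta> by simp
    then show False using b by (simp add: eq_neg_iff_add_eq_0)
  next
    case 2
    have "\<beta> * (b - \<beta> ^ 3) = (\<alpha> + \<beta> ^ 2) * (\<alpha> - \<beta> ^ 2) - (\<alpha> ^ 2 - b * \<beta>)"
      by Groebner_Basis.algebra
    then have "\<beta> * (b - \<beta> ^ 3) = 0" unfolding 2 \<alpha> by simp
    then have b1: "b - \<beta> ^ 3 = 0" using \<open>\<beta> \<noteq> 0\<close> by simp
    have "27 * b + 1 = 27 * (b - \<beta> ^ 3) + (9 * \<beta> ^ 2 - 3 * \<beta> + 1) * (3 * \<beta> + 1)"
      by Groebner_Basis.algebra
    then have "27 * b + 1 = 0" unfolding b1 \<beta> by simp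
    then show False using b by (simp add: eq_neg_iff_add_eq_0)
  qed
qed

lemma monic_cubic_root:
  fixes b :: "'k::field"
  assumes "c1 + c2 + c3 = - 1" "c1 * c2 + c1 * c3 + c2 * c3 = 0" "c1 * c2 * c3 = - b"
  shows "c1 ^ 3 + c1 ^ 2 + b = 0"
proof -
  have "c1 ^ 3 + c1 ^ 2 + b
    = c1 ^ 2 * (c1 + c2 + c3 - - 1) - c1 * (c1 * c2 + c1 * c3 + c2 * c3) + (c1 * c2 * c3 - - b)"
    by Groebner_Basis.algebra
  then show ?thesis unfolding assms by simp
qed

text \<open>The Moebius transformation with \<open>x1 \<mapsto> \<infinity>\<close>, \<open>\<infinity> \<mapsto> a1\<close>, \<open>x2 \<mapsto> a2\<close> and \<open>x3 \<mapsto> a3\<close> exists iff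
  \<open>(ai - a1) * (xi - x1)\<close> does not depend on \<open>i\<close>.\<close>

lemma inverse_match:
  fixes b :: "'k::field"
  assumes b: "b \<noteq> 0" "27 * b \<noteq> - 1" "27 * b \<noteq> - 4"
    and x: "x1 + x2 + x3 = 0" "b * (x1 * x2 + x1 * x3 + x2 * x3) = 1" "b * (x1 * x2 * x3) = - 1"
    and a: "a1 + a2 + a3 = - 1" "a1 * a2 + a1 * a3 + a2 * a3 = 0" "a1 * a2 * a3 = - b"
    and ne: "a1 \<noteq> a2" "a1 \<noteq> a3"
    and eq: "(a2 - a1) * (x2 - x1) = (a3 - a1) * (x3 - x1)"
  shows False
proof -
  define u v p q where "u = x2 - x1" and "v = x3 - x1" and "p = a2 - a1" and "q = a3 - a1"
  note defs = u_def v_def p_def q_def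
  have uv: "u + v = - 3 * x1" "b * (u * v) = 3 * b * x1 ^ 2 + 1"
    using x(1,2) unfolding defs by Groebner_Basis.algebra+
  have pq: "p + q = - 1 - 3 * a1" "p * q = 3 * a1 ^ 2 + 2 * a1"
    using a(1,2) unfolding defs by Groebner_Basis.algebra+
  have up: "u * p = v * q" using eq unfolding defs by (simp add: mult.commute)
  have pq0: "p * q \<noteq> 0" using ne unfolding defs by simp
  have 1: "3 * x1 * (p * q) = u * p * (1 + 3 * a1)"
    using uv(1) up pq(1) by Groebner_Basis.algebra
  \<comment> \<open>Square the previous equation, multiply by b, and use (u p)^2 = (u p)(v q) = (u
    v)(p q) to eliminate u and v.\<close>
  have "(p * q) * ((3 * b * x1 ^ 2 + 1) * (1 + 3 * a1) ^ 2 - 9 * b * x1 ^ 2 * (p * q)) = 0"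
    using 1 uv(2) up by Groebner_Basis.algebra
  then have "(3 * b * x1 ^ 2 + 1) * (1 + 3 * a1) ^ 2 - 9 * b * x1 ^ 2 * (p * q) = 0"
    using pq0 by simp
  then have 2: "3 * b * x1 ^ 2 = - ((3 * a1 + 1) ^ 2)"
    unfolding pq by Groebner_Basis.algebra
  then have 2: "3 * b * x1 ^ 2 + (3 * a1 + 1) ^ 2 = 0" by simp
  have "b * x1 ^ 3 + x1 + 1 = b * x1 ^ 2 * (x1 + x2 + x3)
    - x1 * (b * (x1 * x2 + x1 * x3 + x2 * x3) - 1) + (b * (x1 * x2 * x3) - - 1)"
    by Groebner_Basis.algebra
  then have root: "b * x1 ^ 3 + x1 + 1 = 0" unfolding x by simp
  have roota: "a1 ^ 3 + a1 ^ 2 + b = 0" by (rule monic_cubic_root[OF a])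
  \<comment> \<open>This substitution removes the square term: 27 (a1^3 + a1^2) = m^3 - 3 m +
    2.\<close>
  define m where "m = 3 * a1 + 1"
  have 2: "3 * b * x1 ^ 2 + m ^ 2 = 0" using 2 unfolding m_def .
  have "x1 * (3 - m ^ 2) + 3 = 3 * (b * x1 ^ 3 + x1 + 1) - x1 * (3 * b * x1 ^ 2 + m ^ 2)"
    by Groebner_Basis.algebra
  then have 3: "x1 * (3 - m ^ 2) + 3 = 0" unfolding root 2 by simp
  have "m ^ 2 * (3 - m ^ 2) ^ 2 + 27 * b = (3 - m ^ 2) ^ 2 * (3 * b * x1 ^ 2 + m ^ 2)
    - 3 * b * (x1 * (3 - m ^ 2) - 3) * (x1 * (3 - m ^ 2) + 3)"
    by Groebner_Basis.algebra
  then have 4: "m ^ 2 * (3 - m ^ 2) ^ 2 + 27 * b = 0" unfolding 2 3 by simp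
  have "27 * b + (m ^ 3 - 3 * m) + 2 = 27 * (a1 ^ 3 + a1 ^ 2 + b)" unfolding m_def by Groebner_Basis.algebra
  then have 5: "27 * b + (m ^ 3 - 3 * m) + 2 = 0" unfolding roota by simp
  \<comment> \<open>With w = m^3 - 3 m, the two facts read w^2 + 27 b = 0 and w + 2 + 27 b = 0.
    Their difference is w^2 - w - 2, with the roots 2 and - 1.\<close>
  have "(m ^ 3 - 3 * m - 2) * (m ^ 3 - 3 * m + 1)
    = (m ^ 2 * (3 - m ^ 2) ^ 2 + 27 * b) - (27 * b + (m ^ 3 - 3 * m) + 2)"
    by Groebner_Basis.algebra
  then have "(m ^ 3 - 3 * m - 2) * (m ^ 3 - 3 * m + 1) = 0" unfolding 4 5 by simp
  then consider "m ^ 3 - 3 * m = 2" | "m ^ 3 - 3 * m = - 1"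
    by (metis mult_eq_0_iff eq_iff_diff_eq_0 eq_neg_iff_add_eq_0)
  then show False
  proof cases
    case 1
    then have "27 * b + 4 = 0" using 5 by (simp add: add.commute)
    then show False using b by (simp add: eq_neg_iff_add_eq_0)
  next
    case 2
    then have "27 * b + 1 = 0" using 5 by (simp add: add.commute)
    then show False using b by (simp add: eq_neg_iff_add_eq_0)
  qed
qed

text \<open>If infinity is fixed, the map is affine and \<open>affine_match\<close> applies.
  Otherwise the pole is a root of b x^3 + x + 1. If some ai is the value at infinity,
  \<open>inverse_match\<close> applies; if none is, their three preimages and the pole are four
  distinct roots of a cubic.\<close>

lemma no_moebius:
  fixes b :: "'k::alg_closed_field"
  assumes b: "b \<noteq> 0" "27 * b \<noteq> - 1" "27 * b \<noteq> - 4"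
    and det: "\<alpha> * \<delta> \<noteq> \<beta> * \<gamma>"
    and pole: "\<And>x. \<gamma> * x + \<delta> = 0 \<Longrightarrow> b * x ^ 3 + x + 1 = 0"
    and zero: "\<And>x. (\<alpha> * x + \<beta>) ^ 3 + (\<alpha> * x + \<beta>) ^ 2 * (\<gamma> * x + \<delta>) + b * (\<gamma> * x + \<delta>) ^ 3 = 0
      \<Longrightarrow> b * x ^ 3 + x + 1 = 0"
  shows False
proof -
  obtain a1 where a1: "poly [:b, 0, 1, 1:] a1 = 0"
    using alg_closed_imp_poly_has_root[of "[:b, 0, 1, 1:]"] by auto
  \<comment> \<open>The quadratic is the quotient of t^3 + t^2 + b by t - a1.\<close>
  obtain a2 where a2: "poly [:a1 ^ 2 + a1, 1 + a1, 1:] a2 = 0"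
    using alg_closed_imp_poly_has_root[of "[:a1 ^ 2 + a1, 1 + a1, 1:]"] by auto
  define a3 where "a3 = - 1 - a1 - a2"
  have a: "a1 + a2 + a3 = - 1" "a1 * a2 + a1 * a3 + a2 * a3 = 0" "a1 * a2 * a3 = - b"
  proof -
    have p1: "a1 ^ 3 + a1 ^ 2 + b = 0" and p2: "a2 ^ 2 + a2 + a1 * a2 + a1 ^ 2 + a1 = 0"
      using a1 a2 by (simp_all add: algebra_simps power2_eq_square power3_eq_cube)
    show "a1 + a2 + a3 = - 1" by (simp add: a3_def)
    have "a1 * a2 + a1 * a3 + a2 * a3 = - (a2 ^ 2 + a2 + a1 * a2 + a1 ^ 2 + a1)"
      unfolding a3_def by Groebner_Basis.algebra
    then show "a1 * a2 + a1 * a3 + a2 * a3 = 0" unfolding p2 by simp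
    have "a1 * a2 * a3 = a1 ^ 3 + a1 ^ 2 + b - a1 * (a2 ^ 2 + a2 + a1 * a2 + a1 ^ 2 + a1) - b"
      unfolding a3_def by Groebner_Basis.algebra
    then show "a1 * a2 * a3 = - b" unfolding p1 p2 by simp
  qed
  have ne: "c1 \<noteq> c2" if c: "c1 + c2 + c3 = - 1" "c1 * c2 + c1 * c3 + c2 * c3 = 0" "c1 * c2 * c3 = - b"
    for c1 c2 c3
  proof
    assume c12: "c1 = c2"
    \<comment> \<open>A double root is also a root of the derivative 3 t^2 + 2 t; being nonzero, it
      satisfies 3 t + 2 = 0, which forces 27 b = - 4.\<close>
    have "c1 * (3 * c1 + 2) = 2 * c1 * (c1 + c2 + c3 - - 1) - (c1 * c2 + c1 * c3 + c2 * c3)"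
      unfolding c12[symmetric] by Groebner_Basis.algebra
    then have "c1 * (3 * c1 + 2) = 0" unfolding c by simp
    moreover have "c1 \<noteq> 0" using c b by auto
    ultimately have c1: "3 * c1 + 2 = 0" by simp
    have "27 * b + 4 = (18 * c1 ^ 2 - 3 * c1 + 2) * (3 * c1 + 2) - 27 * c1 ^ 2 * (c1 + c2 + c3 - - 1)
      + 27 * (c1 * c2 * c3 - - b)"
      unfolding c12[symmetric] by Groebner_Basis.algebra
    then have "27 * b + 4 = 0" unfolding c c1 by simp
    then show False using b by (simp add: eq_neg_iff_add_eq_0)
  qed
  have dist: "a1 \<noteq> a2" "a1 \<noteq> a3" "a2 \<noteq> a3"
    using ne[of a1 a2 a3] ne[of a1 a3 a2] ne[of a2 a3 a1] a by (simp_all add: ac_simps)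
  have root: "b * x ^ 3 + x + 1 = 0"
    if "\<alpha> * x + \<beta> = a * (\<gamma> * x + \<delta>)" "a = a1 \<or> a = a2 \<or> a = a3" for x a
  proof (rule zero)
    have a0: "a ^ 3 + a ^ 2 + b = 0"
      using that(2) monic_cubic_root[of a1 a2 a3 b] monic_cubic_root[of a2 a1 a3 b]
        monic_cubic_root[of a3 a1 a2 b] a by (auto simp: ac_simps)
    have "(a * y) ^ 3 + (a * y) ^ 2 * y + b * y ^ 3 = y ^ 3 * (a ^ 3 + a ^ 2 + b)" for y
      by Groebner_Basis.algebra
    then show "(\<alpha> * x + \<beta>) ^ 3 + (\<alpha> * x + \<beta>) ^ 2 * (\<gamma> * x + \<delta>) + b * (\<gamma> * x + \<delta>) ^ 3 = 0"
      unfolding that(1) a0 by simp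
  qed
  have indet: "\<alpha> * x + \<beta> \<noteq> 0" if Q: "\<gamma> * x + \<delta> = 0" for x
  proof
    assume P: "\<alpha> * x + \<beta> = 0"
    have "\<alpha> * \<delta> - \<beta> * \<gamma> = \<alpha> * (\<gamma> * x + \<delta>) - \<gamma> * (\<alpha> * x + \<beta>)" by Groebner_Basis.algebra
    then show False using det unfolding P Q by simp
  qed
  have sep: "x \<noteq> y"
    if "\<alpha> * x + \<beta> = c * (\<gamma> * x + \<delta>)" "\<alpha> * y + \<beta> = d * (\<gamma> * y + \<delta>)" "c \<noteq> d" for x y c d
  proof
    assume "x = y"
    then have "c * (\<gamma> * x + \<delta>) = d * (\<gamma> * x + \<delta>)" using that(1,2) by metis
    then have "\<gamma> * x + \<delta> = 0" using that(3) by (metis mult_right_cancel)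
    then show False using that(1) indet by simp
  qed
  have sep_pole: "x \<noteq> y" if "\<alpha> * x + \<beta> = c * (\<gamma> * x + \<delta>)" "\<gamma> * y + \<delta> = 0" for x y c
    using that indet by auto
  \<comment> \<open>The witness is the inverse transformation at c, defined unless c is the value
    \<alpha> / \<gamma> at infinity.\<close>
  have solve: "\<exists>x. \<alpha> * x + \<beta> = c * (\<gamma> * x + \<delta>)" if "c * \<gamma> \<noteq> \<alpha>" for c
    by (rule exI[of _ "(c * \<delta> - \<beta>) / (\<alpha> - c * \<gamma>)"]) (use that in \<open>simp add: field_simps\<close>)
  show False
  proof (cases "\<gamma> = 0")
    case True
    then have "\<alpha> \<noteq> 0" "\<delta> \<noteq> 0" using det by auto
    with True obtain x1 x2 x3 where x: "\<alpha> * x1 + \<beta> = a1 * (\<gamma> * x1 + \<delta>)"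
      "\<alpha> * x2 + \<beta> = a2 * (\<gamma> * x2 + \<delta>)" "\<alpha> * x3 + \<beta> = a3 * (\<gamma> * x3 + \<delta>)"
      using solve by (metis mult_zero_right)
    have "x1 \<noteq> x2" "x1 \<noteq> x3" "x2 \<noteq> x3" using sep x dist by blast+
    with root x b have vx: "x1 + x2 + x3 = 0" "b * (x1 * x2 + x1 * x3 + x2 * x3) = 1" "b * (x1 * x2 * x3) = - 1"
      by (intro cubic_roots_vieta[of b x1 x2 x3]; blast)+
    have "c = \<alpha> / \<delta> * x + \<beta> / \<delta>" if "\<alpha> * x + \<beta> = c * (\<gamma> * x + \<delta>)" for c x
      using that True \<open>\<delta> \<noteq> 0\<close> by (simp add: field_simps)
    with x show False by (intro affine_match[OF b vx a]) blast+
  next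
    case False
    define x0 where "x0 = - \<delta> / \<gamma>"
    have x0: "\<gamma> * x0 + \<delta> = 0" using False by (simp add: x0_def)
    \<comment> \<open>The statement is made for a triple c1, c2, c3 so that each of the three roots
      can take the place of the value at infinity.\<close>
    have key: "c1 * \<gamma> \<noteq> \<alpha>"
      if c: "c1 + c2 + c3 = - 1" "c1 * c2 + c1 * c3 + c2 * c3 = 0" "c1 * c2 * c3 = - b"
        and cd: "c1 \<noteq> c2" "c1 \<noteq> c3" "c2 \<noteq> c3"
        and ca: "c2 = a1 \<or> c2 = a2 \<or> c2 = a3" "c3 = a1 \<or> c3 = a2 \<or> c3 = a3" for c1 c2 c3
    proof
      assume \<alpha>: "c1 * \<gamma> = \<alpha>"
      then have "c2 * \<gamma> \<noteq> \<alpha>" "c3 * \<gamma> \<noteq> \<alpha>" using cd False by auto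
      then obtain x2 x3 where x: "\<alpha> * x2 + \<beta> = c2 * (\<gamma> * x2 + \<delta>)" "\<alpha> * x3 + \<beta> = c3 * (\<gamma> * x3 + \<delta>)"
        using solve by blast
      have xd: "x0 \<noteq> x2" "x0 \<noteq> x3" "x2 \<noteq> x3" using sep sep_pole x x0 cd by blast+
      have vx: "x0 + x2 + x3 = 0" "b * (x0 * x2 + x0 * x3 + x2 * x3) = 1" "b * (x0 * x2 * x3) = - 1"
        using cubic_roots_vieta[of b x0 x2 x3] pole[OF x0] root[OF x(1) ca(1)] root[OF x(2) ca(2)] xd b
        by blast+
      have "\<gamma> * ((c - c1) * (x - x0)) = \<beta> - c1 * \<delta>"
        if cx: "\<alpha> * x + \<beta> = c * (\<gamma> * x + \<delta>)" for c x
      proof -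
        have "\<gamma> * ((c - c1) * (x - x0)) - (\<beta> - c1 * \<delta>)
          = (\<alpha> - c1 * \<gamma>) * x - (\<alpha> * x + \<beta> - c * (\<gamma> * x + \<delta>)) - (c - c1) * (\<gamma> * x0 + \<delta>)"
          by Groebner_Basis.algebra
        then show ?thesis unfolding cx x0 \<alpha> by simp
      qed
      then have "\<gamma> * ((c2 - c1) * (x2 - x0)) = \<gamma> * ((c3 - c1) * (x3 - x0))"
        using x by simp
      then have "(c2 - c1) * (x2 - x0) = (c3 - c1) * (x3 - x0)" using False by simp
      then show False by (rule inverse_match[OF b vx c cd(1,2)])
    qed
    have "a1 * \<gamma> \<noteq> \<alpha>" "a2 * \<gamma> \<noteq> \<alpha>" "a3 * \<gamma> \<noteq> \<alpha>"
      using key[of a1 a2 a3] key[of a2 a1 a3] key[of a3 a1 a2] a dist by (simp_all add: ac_simps)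
    then obtain x1 x2 x3 where x: "\<alpha> * x1 + \<beta> = a1 * (\<gamma> * x1 + \<delta>)"
      "\<alpha> * x2 + \<beta> = a2 * (\<gamma> * x2 + \<delta>)" "\<alpha> * x3 + \<beta> = a3 * (\<gamma> * x3 + \<delta>)"
      using solve by metis
    have "x1 \<noteq> x2" "x1 \<noteq> x3" "x2 \<noteq> x3" "x1 \<noteq> x0" "x2 \<noteq> x0" "x3 \<noteq> x0"
      using sep sep_pole x x0 dist by blast+
    then show False
      using cubic_four_roots[of b x1 x2 x3 x0] root x pole[OF x0] b by blast
  qed
qed

section \<open>Isomorphisms of the curves\<close>

lemma poly_bezout:
  fixes P Q :: "'a::field poly"
  shows "\<exists>D P' Q' U V. P = D * P' \<and> Q = D * Q' \<and> U * P' + V * Q' = 1"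
proof (induction "euclidean_size Q" arbitrary: P Q rule: less_induct)
  case less
  show ?case
  proof (cases "Q = 0")
    case True
    then show ?thesis by (intro exI[of _ P] exI[of _ 1] exI[of _ 0]) simp
  next
    case False
    then obtain D Q' R U V where D: "Q = D * Q'" "P mod Q = D * R" "U * Q' + V * R = 1"
      using less[of "P mod Q" Q] by (meson mod_size_less)
    have "P = P div Q * Q + P mod Q" by simp
    also have "\<dots> = D * (P div Q * Q' + R)"
      unfolding D(2) by (subst (2) D(1)) (simp add: algebra_simps)
    finally have "P = D * (P div Q * Q' + R)" .
    moreover have "V * (P div Q * Q' + R) + (U - V * (P div Q)) * Q' = 1"
      using D(3) by (simp add: algebra_simps)
    ultimately show ?thesis using D(1) by blast
  qed
qed

lemma bezout_dvd_power:
  fixes P Q :: "'a::comm_ring_1"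
  assumes "U * P + V * Q = 1" "P dvd Q ^ m * s"
  shows "P dvd s"
  using assms(2)
proof (induction m)
  case (Suc m)
  have "Q ^ m * s = (U * P + V * Q) * (Q ^ m * s)" using assms(1) by simp
  also have "\<dots> = P * (U * Q ^ m * s) + V * (Q ^ Suc m * s)" by (simp add: algebra_simps)
  finally show ?case using Suc by (metis dvd_add dvd_mult dvd_triv_left)
qed simp

text \<open>For r = P/Q the polynomial Q^m h(r) is homogeneous of degree m in P and Q, so only the
  pure power of Q survives modulo P and only that of P modulo Q. If m exceeds the degree of h, the
  coefficient of P^m is 0.\<close>

lemma homogenize:
  fixes h :: "'a::field poly" and r :: "'a poly fract"
  assumes r: "r * to_fract Q = to_fract P" and "degree h \<le> m"
  shows "\<exists>H R S. to_fract Q ^ m * poly (map_poly (\<lambda>c. to_fract [:c:]) h) r = to_fract H \<and>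
    H = [:coeff h 0:] * Q ^ m + P * R \<and> H = [:coeff h m:] * P ^ m + Q * S"
  using assms(2)
proof (induction h arbitrary: m)
  case 0
  show ?case by (intro exI[of _ 0]) simp
next
  case (pCons a h)
  show ?case
  proof (cases "h = 0")
    case True
    have "\<exists>S. [:a:] * Q ^ m = [:coeff (pCons a h) m:] * P ^ m + Q * S"
      using True by (cases m) (auto simp: intro: exI[of _ "[:a:] * Q ^ (m - 1)"] exI[of _ 0])
    moreover have "to_fract Q ^ m * poly (map_poly (\<lambda>c. to_fract [:c:]) (pCons a h)) r = to_fract ([:a:] * Q ^ m)"
      using True
      by (simp add: map_poly_pCons unital_hom.power[OF unital_hom_to_fract] mult.commute del: mult_pCons_left mult_pCons_right)
    moreover have "[:a:] * Q ^ m = [:coeff (pCons a h) 0:] * Q ^ m + P * 0" by simp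
    ultimately show ?thesis by blast
  next
    case False
    then obtain k where m: "m = Suc k" and k: "degree h \<le> k"
      using pCons.prems by (cases m) auto
    obtain H R S where H: "to_fract Q ^ k * poly (map_poly (\<lambda>c. to_fract [:c:]) h) r = to_fract H"
      "H = [:coeff h k:] * P ^ k + Q * S"
      using pCons.IH[OF k] by blast
    have "to_fract Q ^ m * poly (map_poly (\<lambda>c. to_fract [:c:]) (pCons a h)) r
      = to_fract [:a:] * to_fract Q ^ m + r * to_fract Q * (to_fract Q ^ k * poly (map_poly (\<lambda>c. to_fract [:c:]) h) r)"
      unfolding m by (simp add: map_poly_pCons algebra_simps)
    also have "\<dots> = to_fract ([:a:] * Q ^ m + P * H)"
      unfolding r H(1) by (simp add: unital_hom.power[OF unital_hom_to_fract] del: mult_pCons_left)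
    finally have 1: "to_fract Q ^ m * poly (map_poly (\<lambda>c. to_fract [:c:]) (pCons a h)) r
      = to_fract ([:a:] * Q ^ m + P * H)" .
    moreover have "[:a:] * Q ^ m + P * H = [:coeff (pCons a h) m:] * P ^ m + Q * ([:a:] * Q ^ k + P * S)"
      unfolding H(2) m by (simp add: algebra_simps del: mult_pCons_left)
    moreover have "[:a:] * Q ^ m + P * H = [:coeff (pCons a h) 0:] * Q ^ m + P * H" by simp
    ultimately show ?thesis by blast
  qed
qed

lemma degree_dvd_linear:
  fixes P :: "'a::field poly"
  assumes "P dvd [:a, b:]" "a \<noteq> 0 \<or> b \<noteq> 0"
  shows "degree P \<le> 1"
proof -
  have "degree P \<le> degree [:a, b:]" using assms by (intro dvd_imp_degree_le) auto
  also have "\<dots> \<le> 1" by simp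
  finally show ?thesis .
qed

text \<open>Write f and F for the two parameter polynomials and r = P/Q for the image of
  \<open>tau\<close>, in lowest terms. Surjectivity gives t f(r)^N = h(r) for some polynomial h,
  which forces r to have degree one. Since f(r) is a unit of k[t, 1/F], its numerator Q^(n+1) f(P/Q)
  divides a power of F.\<close>

lemma curves_isomorphic_imp_moebius:
  fixes c0 c1 e1 e0 d0 d1 f1 f0 :: "'a::field"
  assumes "param_curve n c0 e0" "param_curve n d0 f0"
    and iso: "curves_isomorphic (curve n c0 c1 e1 e0) (curve n d0 d1 f1 f0)"
  obtains P Q U V M where "degree P \<le> 1" "degree Q \<le> 1" "U * P + V * Q = 1"
    "degree P \<noteq> 0 \<or> degree Q \<noteq> 0" "Q dvd param_poly n d0 d1 f1 f0 ^ M"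
    "[:c0:] * Q ^ (n + 1) + [:c1:] * (P * Q ^ n) + [:e1:] * (P ^ n * Q) + [:e0:] * P ^ (n + 1)
      dvd param_poly n d0 d1 f1 f0 ^ M"
proof -
  interpret A: param_curve n c0 c1 e1 e0 by fact
  interpret B: param_curve n d0 d1 f1 f0 by fact
  let ?f = "to_fract :: 'a poly \<Rightarrow> _" and ?t = "[:0, 1:] :: 'a poly"
  let ?e = "\<lambda>c. ?f [:c:]" and ?F = "param_poly n d0 d1 f1 f0"
  obtain \<phi> where \<phi>: "\<And>p q. A.g dvd p - q \<Longrightarrow> B.g dvd \<phi> p - \<phi> q"
    "\<And>p q. B.g dvd \<phi> (p + q) - (\<phi> p + \<phi> q)" "\<And>p q. B.g dvd \<phi> (p * q) - \<phi> p * \<phi> q"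
    "\<And>c. B.g dvd \<phi> (const2 c) - const2 c" "\<And>r. \<exists>p. B.g dvd \<phi> p - r"
    using iso unfolding curves_isomorphic_def by blast
  \<comment> \<open>Composing with \<open>B.eta\<close> turns congruences modulo the second curve
    into equalities in k(t).\<close>
  define \<psi> where "\<psi> p = B.eta (\<phi> p)" for p
  have \<psi>_const: "\<psi> (const2 c) = ?e c" for c
    unfolding \<psi>_def using B.eta_eq[OF \<phi>(4)] by (simp add: B.eta_gens)
  have \<psi>_eq: "\<psi> p = \<psi> q" if "A.g dvd p - q" for p q
    unfolding \<psi>_def using B.eta_eq[OF \<phi>(1)[OF that]] .
  interpret \<psi>: unital_hom \<psi>
  proof
    show "\<psi> (p + q) = \<psi> p + \<psi> q" for p q
      unfolding \<psi>_def B.eta_eq[OF \<phi>(2)] B.eta.add ..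
    show "\<psi> (p * q) = \<psi> p * \<psi> q" for p q
      unfolding \<psi>_def B.eta_eq[OF \<phi>(3)] B.eta.mult ..
    show "\<psi> 1 = 1" using \<psi>_const[of 1] by (simp add: A.const2.one A.e.one)
  qed
  define r where "r = \<psi> A.tau"
  have at_tau: "\<psi> (A.at_tau h) = poly (map_poly ?e h) r" for h
    using A.unital_hom_at_tau[OF \<psi>.unital_hom_axioms] by (simp add: \<psi>_const r_def)
  define fr where "fr = \<psi> A.ftau"
  have frZ: "fr * \<psi> A.Z = 1"
    using \<psi>_eq[OF A.dvd_Z] by (simp add: \<psi>.mult \<psi>.one fr_def mult.commute)
  have fr0: "fr \<noteq> 0" using frZ by auto
  have fr: "fr = poly (map_poly ?e A.f) r" unfolding fr_def A.ftau_eq at_tau ..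
  have fr': "fr = ?e c0 + ?e c1 * r + r ^ n * (?e e1 + ?e e0 * r)"
    unfolding fr_def A.ftau_def r_def by (simp add: \<psi>.simps \<psi>_const)

  obtain p where "B.g dvd \<phi> p - B.tau" using \<phi>(5) by blast
  then have p: "\<psi> p = ?f ?t" unfolding \<psi>_def using B.eta_eq B.eta_tau by metis
  obtain N h where "A.g dvd A.ftau ^ N * p - A.at_tau h" using A.clear_denominators by blast
  from \<psi>_eq[OF this] have h: "fr ^ N * ?f ?t = poly (map_poly ?e h) r"
    by (simp add: \<psi>.simps p at_tau fr_def)

  obtain M P0 where P0: "?f ?F ^ M * r = ?f P0" using B.eta_image unfolding r_def \<psi>_def by blast
  obtain M' P1 where P1: "?f ?F ^ M' * \<psi> A.Z = ?f P1" using B.eta_image unfolding \<psi>_def by blast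
  obtain D P Q U V where D: "P0 = D * P" "?F ^ M = D * Q" and bez: "U * P + V * Q = 1"
    using poly_bezout by blast
  have F0: "?F ^ k \<noteq> 0" for k using B.f_nonzero by simp
  have "D \<noteq> 0" "Q \<noteq> 0" using D(2) F0[of M] by auto
  have "?f D * (r * ?f Q) = ?f D * ?f P"
    using P0 unfolding A.frac.power[symmetric] D by (simp add: mult_ac)
  then have rQ: "r * ?f Q = ?f P" using \<open>D \<noteq> 0\<close> by simp

  \<comment> \<open>Both sides of h(r) = t f(r)^N have to be homogenized in the same degree.\<close>
  define m where "m = max (degree h) (degree (A.f ^ N))"
  obtain H R S where H: "?f Q ^ m * poly (map_poly ?e h) r = ?f H"
    "H = [:coeff h 0:] * Q ^ m + P * R" "H = [:coeff h m:] * P ^ m + Q * S"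
    using homogenize[OF rQ max.cobounded1] unfolding m_def by blast
  obtain H' R' S' where H': "?f Q ^ m * poly (map_poly ?e (A.f ^ N)) r = ?f H'"
    "H' = [:coeff (A.f ^ N) 0:] * Q ^ m + P * R'" "H' = [:coeff (A.f ^ N) m:] * P ^ m + Q * S'"
    using homogenize[OF rQ max.cobounded2] unfolding m_def by blast
  have fN: "poly (map_poly ?e (A.f ^ N)) r = fr ^ N"
    unfolding fr by (rule unital_hom.power[OF A.e.unital_hom_eval])
  have "?f H = ?f Q ^ m * fr ^ N * ?f ?t"
    unfolding H(1)[symmetric] h[symmetric] by (simp only: mult.assoc)
  also have "\<dots> = ?f (?t * H')"
    unfolding fN[symmetric] H'(1) by (simp only: to_fract_mult mult.commute)
  finally have "?f H = ?f (?t * H')" .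
  then have HH: "H = ?t * H'" by (simp only: to_fract_eq_iff)
  \<comment> \<open>The equation \<open>h(r) = t f(r)^N\<close>, homogenized and read modulo \<open>P\<close> and modulo \<open>Q\<close>, bounds their degrees.\<close>
  have linear_eq: "[:a, - b:] = [:a:] - ?t * [:b:]" for a b :: 'a by simp
  have "Q ^ m * [:coeff h 0, - coeff (A.f ^ N) 0:] = P * (?t * R' - R)"
    using HH unfolding linear_eq H(2) H'(2) by (simp add: algebra_simps del: mult_pCons_left mult_pCons_right)
  then have Pdvd: "P dvd [:coeff h 0, - coeff (A.f ^ N) 0:]"
    using bezout_dvd_power[OF bez] by (metis dvd_triv_left)
  have "coeff (A.f ^ N) 0 \<noteq> 0"
    using A.c0 A.poly_f_0 by (simp add: flip: poly_0_coeff_0)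
  then have degP: "degree P \<le> 1" by (intro degree_dvd_linear[OF Pdvd]) simp
  have "P ^ m * [:coeff h m, - coeff (A.f ^ N) m:] = Q * (?t * S' - S)"
    using HH unfolding linear_eq H(3) H'(3) by (simp add: algebra_simps del: mult_pCons_left mult_pCons_right)
  moreover have "V * Q + U * P = 1" using bez by (simp add: add.commute)
  ultimately have Qdvd: "Q dvd [:coeff h m, - coeff (A.f ^ N) m:]"
    using bezout_dvd_power by (metis dvd_triv_left)
  \<comment> \<open>As \<open>m\<close> is the larger of the two degrees, one top coefficient
    survives, so the linear polynomial divisible by \<open>Q\<close> is nonzero.\<close>
  have "coeff h m \<noteq> 0 \<or> coeff (A.f ^ N) m \<noteq> 0"
  proof (cases "degree h \<le> degree (A.f ^ N)")
    case True
    then have "m = degree (A.f ^ N)" by (simp add: m_def)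
    then show ?thesis using A.f_nonzero by (metis leading_coeff_neq_0 power_not_zero)
  next
    case False
    then have "m = degree h" "h \<noteq> 0" by (auto simp: m_def)
    then show ?thesis by simp
  qed
  then have degQ: "degree Q \<le> 1" by (intro degree_dvd_linear[OF Qdvd]) simp

  \<comment> \<open>For constant r the equation t f(r)^N = h(r) has a constant right-hand side, so
    f(r) = 0, although f(r) is invertible.\<close>
  have nonconst: "degree P \<noteq> 0 \<or> degree Q \<noteq> 0"
  proof (rule ccontr)
    assume "\<not> ?thesis"
    then obtain a b where ab: "P = [:a:]" "Q = [:b:]" by (auto elim!: degree_eq_zeroE)
    then have "b \<noteq> 0" using \<open>Q \<noteq> 0\<close> by auto
    have "[:a:] = [:a / b:] * [:b:]" using \<open>b \<noteq> 0\<close> by simp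
    then have "r * ?f [:b:] = ?e (a / b) * ?f [:b:]"
      using rQ unfolding ab to_fract_mult[symmetric] by simp
    then have "r = ?e (a / b)" using \<open>b \<noteq> 0\<close> by simp
    then have const: "poly (map_poly ?e k) r = ?e (poly k (a / b))" for k
      by (simp add: A.e.hom_poly)
    have "fr ^ N * ?f ?t = ?f ([:poly A.f (a / b):] ^ N * ?t)"
      unfolding fr const by (simp add: A.frac.simps del: mult_pCons_right)
    then have "?f ([:poly A.f (a / b):] ^ N * ?t) = ?f [:poly h (a / b):]"
      using h unfolding const by simp
    then have "[:poly A.f (a / b):] ^ N * ?t = [:poly h (a / b):]"
      by (simp only: to_fract_eq_iff)
    moreover have "[:poly A.f (a / b):] ^ N = [:poly A.f (a / b) ^ N:]" by (simp add: poly_const_pow)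
    ultimately have "poly A.f (a / b) = 0" by simp
    then have "fr = 0" unfolding fr const by simp
    then show False using fr0 by simp
  qed

  \<comment> \<open>This is Q^(n+1) f(P/Q). The factor Q^(n+1) arising on the other side is
    absorbed, because \<open>Q\<close> divides a power of the second polynomial.\<close>
  let ?G = "[:c0:] * Q ^ (n + 1) + [:c1:] * (P * Q ^ n) + [:e1:] * (P ^ n * Q) + [:e0:] * P ^ (n + 1)"
  have "?f ?G = fr * ?f Q ^ (n + 1)"
    unfolding fr' A.frac.add A.frac.mult A.frac.power rQ[symmetric]
    by (simp add: power_mult_distrib algebra_simps)
  then have "?f (?G * P1) = fr * ?f Q ^ (n + 1) * (?f ?F ^ M' * \<psi> A.Z)"
    unfolding P1 by (simp only: A.frac.mult)
  also have "\<dots> = ?f (Q ^ (n + 1) * ?F ^ M') * (fr * \<psi> A.Z)"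
    unfolding A.frac.mult A.frac.power by (simp add: mult_ac)
  finally have "?G * P1 = Q ^ (n + 1) * ?F ^ M'"
    unfolding frZ mult_1_right by (simp only: to_fract_eq_iff)
  then have "?G dvd Q ^ (n + 1) * ?F ^ M'" by (metis dvd_triv_left)
  also have "\<dots> dvd (?F ^ M) ^ (n + 1) * ?F ^ M'"
    unfolding D(2) by (intro mult_dvd_mono dvd_power_same) simp_all
  also have "\<dots> = ?F ^ (M * (n + 1) + M')" by (simp only: power_mult power_add)
  finally have G: "?G dvd ?F ^ (M * (n + 1) + M')" .
  have "Q dvd ?F ^ M" unfolding D(2) by simp
  then have "Q dvd ?F ^ (M * (n + 1) + M')"
    by (rule dvd_trans) (intro le_imp_power_dvd, simp)
  with G show ?thesis using that degP degQ bez nonconst by blast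
qed

section \<open>The two choices of the polynomial\<close>

lemma degree_le_1_imp_linear:
  fixes p :: "'a::zero poly"
  assumes "degree p \<le> 1"
  shows "\<exists>a b. p = [:a, b:]"
proof -
  have "p = [:coeff p 0, coeff p 1:]"
    using assms by (intro poly_eqI) (auto simp: coeff_pCons coeff_eq_0 split: nat.splits)
  then show ?thesis by blast
qed

text \<open>Here f = t^3 + t^2 + b, with reversed polynomial b t^3 + t + 1. Over the algebraic
  closure the two divisibilities become the hypotheses \<open>pole\<close> and \<open>zero\<close>
  of \<open>no_moebius\<close>.\<close>

lemma curves_not_isomorphic_septic:
  fixes b :: "'a::field"
  assumes b: "b \<noteq> 0" "27 * b \<noteq> - 1" "27 * b \<noteq> - 4"
  shows "\<not> curves_isomorphic (curve 2 b 0 1 1) (curve 2 1 1 0 b)"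
proof
  assume iso: "curves_isomorphic (curve 2 b 0 1 1) (curve 2 1 1 0 b)"
  have "param_curve 2 b 1" "param_curve 2 1 b" using b by (simp_all add: param_curve_def)
  from curves_isomorphic_imp_moebius[OF this iso] obtain P Q U V M
    where deg: "degree P \<le> 1" "degree Q \<le> 1" and bez: "U * P + V * Q = 1"
      and nonconst: "degree P \<noteq> 0 \<or> degree Q \<noteq> 0"
      and Q: "Q dvd param_poly 2 1 1 0 b ^ M"
      and G: "[:b:] * Q ^ (2 + 1) + [:0:] * (P * Q ^ 2) + [:1:] * (P ^ 2 * Q) + [:1:] * P ^ (2 + 1)
        dvd param_poly 2 1 1 0 b ^ M"
    by blast
  obtain \<alpha> \<beta> \<gamma> \<delta> where PQ: "P = [:\<beta>, \<alpha>:]" "Q = [:\<delta>, \<gamma>:]"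
    using deg by (meson degree_le_1_imp_linear)
  let ?b = "to_ac b" and ?\<alpha> = "to_ac \<alpha>" and ?\<beta> = "to_ac \<beta>" and ?\<gamma> = "to_ac \<gamma>" and ?\<delta> = "to_ac \<delta>"
  have b': "?b \<noteq> 0" "27 * ?b \<noteq> - 1" "27 * ?b \<noteq> - 4"
    using b to_ac_eq_iff[of b 0] to_ac_eq_iff[of "27 * b" "- 1"] to_ac_eq_iff[of "27 * b" "- 4"]
    by (simp_all del: to_ac_eq_iff to_ac_eq_0_iff)
  have root: "?b * x ^ 3 + x + 1 = 0"
    if "p dvd param_poly 2 1 1 0 b ^ M" "poly (map_poly to_ac p) x = 0" for p x
  proof -
    interpret ev: unital_hom "\<lambda>p. poly (map_poly to_ac p) x"
      by (rule unital_hom.unital_hom_eval[OF unital_hom_to_ac])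
    have "poly (map_poly to_ac (param_poly 2 1 1 0 b)) x ^ M = 0"
      using ev.dvd[OF that(1)] that(2) by (simp add: ev.power)
    then have "poly (map_poly to_ac (param_poly 2 1 1 0 b)) x = 0" by simp
    then show ?thesis
      unfolding param_poly_def ev.simps
      by (simp add: map_poly_pCons algebra_simps power2_eq_square power3_eq_cube)
  qed
  \<comment> \<open>A vanishing determinant either makes both polynomials constant or gives them the
    common root - \<delta> / \<gamma>, against the Bezout identity.\<close>
  have "\<alpha> * \<delta> \<noteq> \<beta> * \<gamma>"
  proof
    assume det: "\<alpha> * \<delta> = \<beta> * \<gamma>"
    show False
    proof (cases "\<gamma> = 0")
      case True
      have "Q \<noteq> 0"
      proof
        assume "Q = 0"
        then have "param_poly 2 1 1 0 b = 0" using Q by simp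
        moreover have "poly (param_poly 2 1 1 0 b) 0 = 1" by (simp add: param_poly_def)
        ultimately show False by simp
      qed
      then show False using True det nonconst unfolding PQ by (auto split: if_splits)
    next
      case False
      have "poly (U * P + V * Q) (- \<delta> / \<gamma>) = 1" unfolding bez by simp
      moreover have "poly P (- \<delta> / \<gamma>) = 0" "poly Q (- \<delta> / \<gamma>) = 0"
        using False det unfolding PQ by (simp_all add: field_simps)
      ultimately show False by simp
    qed
  qed
  then have det: "?\<alpha> * ?\<delta> \<noteq> ?\<beta> * ?\<gamma>" by (simp flip: to_ac_mult)
  show False
  proof (rule no_moebius[OF b' det])
    show "?b * x ^ 3 + x + 1 = 0" if "?\<gamma> * x + ?\<delta> = 0" for x
      using that by (intro root[OF Q]) (simp add: PQ map_poly_pCons algebra_simps)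
    show "?b * x ^ 3 + x + 1 = 0"
      if "(?\<alpha> * x + ?\<beta>) ^ 3 + (?\<alpha> * x + ?\<beta>) ^ 2 * (?\<gamma> * x + ?\<delta>) + ?b * (?\<gamma> * x + ?\<delta>) ^ 3 = 0" for x
    proof (rule root[OF G])
      interpret ev: unital_hom "\<lambda>p. poly (map_poly to_ac p) x"
        by (rule unital_hom.unital_hom_eval[OF unital_hom_to_ac])
      have PQx: "poly (map_poly to_ac P) x = ?\<alpha> * x + ?\<beta>" "poly (map_poly to_ac Q) x = ?\<gamma> * x + ?\<delta>"
        unfolding PQ by (simp_all add: map_poly_pCons algebra_simps)
      show "poly (map_poly to_ac ([:b:] * Q ^ (2 + 1) + [:0:] * (P * Q ^ 2) + [:1:] * (P ^ 2 * Q)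
        + [:1:] * P ^ (2 + 1))) x = 0"
        unfolding ev.simps PQx using that
        by (simp add: map_poly_pCons add_ac mult_ac power2_eq_square power3_eq_cube)
    qed
  qed
qed

lemma two_element_field:
  assumes "card (UNIV :: 'a::field set) = 2"
  shows "(x::'a) = 0 \<or> x = 1" "(1::'a) + 1 = 0"
proof -
  have "finite (UNIV :: 'a set)" using assms card.infinite by fastforce
  then have "{0, 1} = (UNIV :: 'a set)" using assms by (intro card_seteq) simp_all
  then show all: "x = 0 \<or> x = 1" for x :: 'a by blast
  show "(1::'a) + 1 = 0" using all[of "1 + 1"] by (metis add_cancel_right_right one_neq_zero)
qed

text \<open>Here f = t^4 + t + 1, with reversed polynomial t^4 + t^3 + 1. The latter has no root in
  the field, so infinity must be fixed and the transformation is t or t + 1. Both preserve f, which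
  is coprime to its reversal.\<close>

lemma curves_not_isomorphic_two_element:
  assumes "card (UNIV :: 'a::field set) = 2"
  shows "\<not> curves_isomorphic (curve 3 1 1 0 1) (curve 3 1 0 1 (1::'a))"
proof
  let ?F = "param_poly 3 1 0 1 (1::'a)"
  assume iso: "curves_isomorphic (curve 3 1 1 0 1) (curve 3 1 0 1 (1::'a))"
  have "param_curve 3 1 (1::'a)" by (simp add: param_curve_def)
  from curves_isomorphic_imp_moebius[OF this this iso] obtain P Q :: "'a poly" and U V M
    where deg: "degree P \<le> 1" "degree Q \<le> 1" and bez: "U * P + V * Q = 1"
      and nonconst: "degree P \<noteq> 0 \<or> degree Q \<noteq> 0" and Q: "Q dvd ?F ^ M"
      and G: "[:1:] * Q ^ (3 + 1) + [:1:] * (P * Q ^ 3) + [:0:] * (P ^ 3 * Q) + [:1:] * P ^ (3 + 1) dvd ?F ^ M"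
    by blast
  note F2 = two_element_field[OF assms]
  have F: "?F = [:1, 0, 0, 1, 1:]" by (simp add: param_poly_def numeral_3_eq_3)
  obtain \<alpha> \<beta> \<gamma> \<delta> where PQ: "P = [:\<beta>, \<alpha>:]" "Q = [:\<delta>, \<gamma>:]"
    using deg by (meson degree_le_1_imp_linear)
  have "poly ?F x \<noteq> 0" for x
    using F2(1)[of x] F2(2) unfolding F by auto
  moreover have "poly Q x dvd poly ?F x ^ M" for x
    using Q by (metis dvd_def poly_mult poly_power)
  ultimately have Qx: "poly Q x \<noteq> 0" for x by (metis dvd_0_left power_not_zero)
  \<comment> \<open>A polynomial of degree at most 1 that vanishes at neither 0 nor 1 is constant
    over this field.\<close>
  have Q1: "Q = 1"
    using Qx[of 0] Qx[of 1] F2(1)[of \<gamma>] F2(1)[of \<delta>] F2(2) unfolding PQ by (auto simp: one_pCons)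
  then have "\<alpha> = 1" using nonconst F2(1)[of \<alpha>] unfolding PQ by auto
  have two: "a + a = 0" for a :: 'a using F2(1)[of a] F2(2) by auto
  \<comment> \<open>Both values of \<beta> give the same polynomial, as t^4 + t + 1 is invariant
    under t -> t + 1.\<close>
  have "[:1, 1, 0, 0, 1:] dvd ?F ^ M * 1"
    using G F2(1)[of \<beta>] \<open>\<alpha> = 1\<close> unfolding Q1 PQ by (auto simp: eval_nat_numeral one_pCons two)
  moreover have "[:1, 1, 0, 1:] * [:1, 1, 0, 0, 1:] + [:0, 0, 1, 1:] * ?F = 1"
    unfolding F by (simp add: one_pCons two)
  ultimately have "[:1, 1, 0, 0, 1::'a:] dvd 1" using bezout_dvd_power by blast
  then show False by (simp add: is_unit_poly_iff)
qed

text \<open>In characteristic 2 the conditions say that b is neither 0 nor 1. Otherwise b = 1 works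
  unless 28 or 31 vanishes, and then b = - 1 works, since 26 and 23 are nonzero.\<close>

lemma good_parameter:
  assumes "infinite (UNIV :: 'a::field set) \<or> card (UNIV :: 'a set) > 2"
  shows "\<exists>b::'a. b \<noteq> 0 \<and> 27 * b \<noteq> - 1 \<and> 27 * b \<noteq> - 4"
proof (cases "(2::'a) = 0")
  case True
  have "\<not> (UNIV :: 'a set) \<subseteq> {0, 1}"
  proof
    assume *: "(UNIV :: 'a set) \<subseteq> {0, 1}"
    then have "finite (UNIV :: 'a set)" by (rule finite_subset) simp
    moreover have "card (UNIV :: 'a set) \<le> 2" using card_mono[OF _ *] by simp
    ultimately show False using assms by simp
  qed
  then obtain b :: 'a where b: "b \<noteq> 0" "b \<noteq> 1" by blast
  have "27 * b = 2 * (13 * b) + b" "(- 1 :: 'a) = 1 - 2" "(- 4 :: 'a) = - (2 * 2)" by simp_all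
  then show ?thesis using b True by (intro exI[of _ b]) auto
next
  case False
  show ?thesis
  proof (cases "(28::'a) = 0 \<or> (31::'a) = 0")
    case True
    have "(26::'a) \<noteq> 0 \<and> (23::'a) \<noteq> 0"
      using True
    proof
      assume 28: "(28::'a) = 0"
      have "(28::'a) = 26 + 2" "(1::'a) = 11 * 23 - 9 * 28" by simp_all
      then show ?thesis using 28 \<open>(2::'a) \<noteq> 0\<close>
        by (metis add_0 diff_self mult_zero_right zero_neq_one)
    next
      assume 31: "(31::'a) = 0"
      have "(1::'a) = 6 * 26 - 5 * 31" "(1::'a) = 3 * 31 - 4 * 23" by simp_all
      then show ?thesis using 31 by (metis diff_self mult_zero_right zero_neq_one)
    qed
    then show ?thesis by (intro exI[of _ "-1"]) (simp add: eq_neg_iff_add_eq_0)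
  next
    case False
    then show ?thesis by (intro exI[of _ 1]) (simp add: eq_neg_iff_add_eq_0)
  qed
qed

theorem theorem3:
  shows "\<exists>f g :: 'a::field bipoly.
           geom_irreducible f \<and> geom_irreducible g \<and>
           \<not> curves_isomorphic f g \<and> complements_isomorphic f g \<and>
           ((infinite (UNIV :: 'a set) \<or> card (UNIV :: 'a set) > 2) \<longrightarrow>
               total_degree f = 7 \<and> total_degree g = 7) \<and>
           (card (UNIV :: 'a set) = 2 \<longrightarrow> total_degree f = 13 \<and> total_degree g = 13)"
proof (cases "card (UNIV :: 'a set) = 2")
  case True
  have p: "param_curve 3 1 (1::'a)" by (simp add: param_curve_def)
  \<comment> \<open>An infinite set has \<open>card\<close> 0, so cardinality 2 excludes the
    infinite alternative.\<close>
  have "finite (UNIV :: 'a set)" using True card.infinite by fastforce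
  then show ?thesis
    using True geom_irreducible_curve[OF p, of 1 0] geom_irreducible_curve[OF p, of 0 1]
      curves_not_isomorphic_two_element[OF True] complements_isomorphic_curve[OF p, of 1 0]
      param_curve.total_degree_g[OF p, of 1 0] param_curve.total_degree_g[OF p, of 0 1]
    by (intro exI[of _ "curve 3 1 1 0 1"] exI[of _ "curve 3 1 0 1 1"]) simp
next
  case False
  have "infinite (UNIV :: 'a set) \<or> card (UNIV :: 'a set) > 2"
  proof (rule disjCI)
    assume "\<not> card (UNIV :: 'a set) > 2"
    moreover have "card {0, 1::'a} \<le> card (UNIV :: 'a set)" if "finite (UNIV :: 'a set)"
      by (rule card_mono) (use that in simp_all)
    ultimately show "infinite (UNIV :: 'a set)" using False by auto
  qed
  then obtain b :: 'a where b: "b \<noteq> 0" "27 * b \<noteq> - 1" "27 * b \<noteq> - 4"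
    using good_parameter by blast
  have p: "param_curve 2 b 1" "param_curve 2 1 b" using b by (simp_all add: param_curve_def)
  show ?thesis
    using False geom_irreducible_curve[OF p(1), of 0 1] geom_irreducible_curve[OF p(2), of 1 0]
      curves_not_isomorphic_septic[OF b] complements_isomorphic_curve[OF p(1), of 0 1]
      param_curve.total_degree_g[OF p(1), of 0 1] param_curve.total_degree_g[OF p(2), of 1 0]
    by (intro exI[of _ "curve 2 b 0 1 1"] exI[of _ "curve 2 1 1 0 b"]) simp
qed

end
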